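(* Let $\Delta$ be an infinite additive subgroup of $\mathbb{C}$, let $b\in\mathbb{C}$ with $2b\notin\Delta$, and let $\varphi:\Delta\to\mathbb{C}^+$ be a group homomorphism. Let $V$ be a non-trivial $\Delta$-graded free intermediate series module over $CL(b,\varphi)$. Then $V$ is isomorphic to either $V_{c,e}$ (for some $c,e\in\mathbb{C}$), or $V_{A_1,c}$, or $V_{A_2,c}$ (for some $c\in\mathbb{C}$ and some sequence $A_1$, respectively $A_2$), where these modules are the ones defined in the context.
   Context: $\mathbb{C}^+$ is the additive group of $\mathbb{C}$. A Lie conformal algebra $R$ is a $\mathbb{C}[\partial]$-module with a $\mathbb{C}$-bilinear map $R\times R\to R[\lambda]$, $(a,b)\mapsto[a_\lambda b]$, satisfying $[\partial a_\lambda b]=-\lambda[a_\lambda b]$, $[a_\lambda\partial b]=(\lambda+\partial)[a_\lambda b]$, $[a_\lambda b]=-[b_{-\lambda-\partial}a]$ and $[a_\lambda[b_\mu c]]=[[a_\lambda b]_{\lambda+\mu}c]+[b_\mu[a_\lambda c]]$. $CL(b,\varphi)=\bigoplus_{\alpha\in\Delta}\mathbb{C}[\partial]x_\alpha$ is the Lie conformal algebra, free over $\mathbb{C}[\partial]$ on $\{x_\alpha\}_{\alpha\in\Delta}$, with $$[{x_\alpha}_\lambda x_\beta]=\big((\alpha+b)\partial+(\alpha+\beta+2b)\lambda\big)x_{\alpha+\beta}+\tfrac1b\big(\varphi(\alpha)\beta-\varphi(\beta)\alpha+b(\varphi(\alpha)-\varphi(\beta))\big)x_{\alpha+\beta}.$$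 A module $M$ over $R$ is a $\mathbb{C}[\partial]$-module with a $\mathbb{C}$-bilinear map $R\times M\to M[\lambda]$, $(a,v)\mapsto a_\lambda v$, such that $(\partial a)_\lambda v=-\lambda a_\lambda v$, $a_\lambda(\partial v)=(\partial+\lambda)a_\lambda v$, $[a_\lambda b]_{\lambda+\mu}v=a_\lambda(b_\mu v)-b_\mu(a_\lambda v)$. It is non-trivial if the action is not identically zero. A $\Delta$-graded module over $CL(b,\varphi)$ is a module $V=\bigoplus_{\alpha\in\Delta}V_\alpha$ with $\mathbb{C}[\partial]$-submodules $V_\alpha$ such that ${x_\alpha}_\lambda V_\beta\subset V_{\alpha+\beta}[\lambda]$. It is a free intermediate series module if each $V_\alpha$ is freely generated over $\mathbb{C}[\partial]$ by one element. In the following definitions each module is $\bigoplus_{\gamma\in\Delta}\mathbb{C}[\partial]M_\gamma$, free over $\mathbb{C}[\partial]$ on $\{M_\gamma\}$. $V_{c,e}$ ($c,e\in\mathbb{C}$): $${x_\beta}_\lambda M_\gamma=(\beta+b)\Big(c-\tfrac{\varphi(\beta+\gamma)}{b}+\tfrac{\varphi(\beta)}{\beta+b}\big(e+\tfrac{\beta+\gamma}{b}\big)+\tfrac{b}{\beta+b}\big(e+\tfrac{\beta+\gamma}{b}\big)\lambda+\partial\Big)M_{\beta+\gamma}.$$ A sequence $A_1=\{q_\alpha\mid\alpha\in\Delta\}$ is one for which there is $\gamma_0\in\Delta$ with $q_{\gamma_0}=0$ and $q_{\alpha+\gamma_0}=1+\frac{\alpha}{b}$ for all $\alpha\neq0$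 in $\Delta$. $V_{A_1,c}$ ($c\in\mathbb{C}$): ${x_\beta}_\lambda M_\gamma$ equals - $(\beta+b)\big(\partial+c-\tfrac{\varphi(\beta+\gamma)}{b}\big)\big(\partial+\tfrac{b}{\beta+b}\lambda+c-\tfrac{\varphi(\beta+\gamma)}{b}+\tfrac{\varphi(\beta)}{\beta+b}\big)M_{\beta+\gamma}$ if $\beta\neq0$, $q_{\beta+\gamma}=0$, $q_\gamma=1-\frac{\beta}{b}$; - $(\beta+b)M_{\beta+\gamma}$ if $\beta\neq0$, $q_\gamma=0$, $q_{\beta+\gamma}=1+\frac{\beta}{b}$; - $(\beta+b)\big(\partial+\tfrac{b}{\beta+b}q_{\beta+\gamma}\lambda+\tfrac{\varphi(\beta)}{\beta+b}q_{\beta+\gamma}+c-\tfrac{\varphi(\beta+\gamma)}{b}\big)M_{\beta+\gamma}$ otherwise. A sequence $A_2=\{q_\alpha\mid\alpha\in\Delta\}$ is one for which there is $\gamma_0\in\Delta$ with $q_{\gamma_0}=1$ and $q_{\beta+\gamma_0}=\frac{\beta}{b}$ for all $\beta\neq0$ in $\Delta$. $V_{A_2,c}$ ($c\in\mathbb{C}$): ${x_\beta}_\lambda M_\gamma$ equals - $(\beta+b)M_{\beta+\gamma}$ if $\beta\neq0$, $q_{\beta+\gamma}=1$, $q_\gamma=-\frac{\beta}{b}$; - $(\beta+b)\Big(\big(\partial+c-\tfrac{\varphi(\beta+\gamma)}{b}\big)\big(\partial+\tfrac{2\beta+b}{\beta+b}\lambda+c-\tfrac{\varphi(\beta+\gamma)}{b}+\tfrac{(2\beta+b)\varphi(\beta)}{b(\beta+b)}\big)+\tfrac{\beta}{\beta+b}\big(\lambda+\tfrac{\varphi(\beta)}{b}\big)^2\Big)M_{\beta+\gamma}$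 if $\beta\neq0$, $q_{\beta+\gamma}=\frac{\beta}{b}$, $q_\gamma=1$; - $(\beta+b)\big(\partial+\tfrac{b}{\beta+b}q_{\beta+\gamma}\lambda+\tfrac{\varphi(\beta)}{\beta+b}q_{\beta+\gamma}+c-\tfrac{\varphi(\beta+\gamma)}{b}\big)M_{\beta+\gamma}$ otherwise. *)

theory Defs
  imports Complex_Main "HOL-Library.Poly_Mapping" "HOL-Computational_Algebra.Polynomial"
begin

section \<open>Lie conformal algebras and their modules\<close>

text \<open>
  A \<open>\<complex>[\<partial>]\<close>-module is given by a ring action \<open>scale :: complex poly \<Rightarrow> 'a \<Rightarrow> 'a\<close> in the sense of
  \<^locale>\<open>module\<close>, so \<open>\<partial>\<close> acts as \<open>scale [:0, 1:]\<close> and a scalar \<open>c\<close> acts as \<open>scale [:c:]\<close>. Algebras and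
  modules have a carrier that is a submodule of the ambient type.
  For a \<open>\<complex>[\<partial>]\<close>-module \<open>M\<close> with elements in \<open>'a\<close>, the elements of \<open>M[\<lambda>]\<close> are the members of \<open>'a poly\<close>
  with coefficients in \<open>M\<close>. Multiplication by \<open>\<lambda>\<close> is \<open>pCons 0\<close>, and a map is applied
  coefficientwise with \<open>map_poly\<close>.

  The type \<open>complex poly poly\<close> plays two roles. As \<open>\<complex>[\<partial>][\<lambda>]\<close> its inner variable is \<open>\<partial>\<close> and its outer
  variable is \<open>\<lambda>\<close>; as \<open>\<complex>[\<lambda>][\<mu>]\<close> its inner variable is \<open>\<lambda>\<close> and its outer variable is \<open>\<mu>\<close>.
\<close>

definition cst :: "complex \<Rightarrow> complex poly poly" where "cst c = [:[:c:]:]"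
definition inner_var :: "complex poly poly" where "inner_var = [:[:0, 1:]:]"
definition outer_var :: "complex poly poly" where "outer_var = [:0, 1:]"

text \<open>\<open>lambda_subst scale s q\<close> is \<open>q = \<Sum>\<lambda>\<^sup>n q\<^sub>n\<close> with \<open>\<lambda>\<close> replaced by \<open>s \<in> \<complex>[\<partial>][\<lambda>]\<close>, the powers of \<open>s\<close>
  standing to the left of the coefficients.\<close>

definition lambda_subst ::
    "(complex poly \<Rightarrow> 'a::ab_group_add \<Rightarrow> 'a) \<Rightarrow> complex poly poly \<Rightarrow> 'a poly \<Rightarrow> 'a poly" where
  "lambda_subst scale s q = (\<Sum>n\<le>degree q. map_poly (\<lambda>p. scale p (coeff q n)) (s ^ n))"

text \<open>If \<open>q = \<Sum>\<^sub>k \<nu>\<^sup>k q\<^sub>k\<close> and \<open>f q\<^sub>k = \<Sum>\<^sub>j \<nu>\<^sup>j r\<^sub>k\<^sub>j\<close>, then \<open>lambda_compose scale s t f q\<close> is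
  \<open>\<Sum>\<^sub>k\<^sub>,\<^sub>j s\<^sup>k t\<^sup>j r\<^sub>k\<^sub>j\<close>, a polynomial in \<open>\<lambda>\<close> (inner) and \<open>\<mu>\<close> (outer), where \<open>s, t \<in> \<complex>[\<lambda>][\<mu>]\<close>. Thus
  \<open>a\<^sub>s(b\<^sub>t v)\<close> is \<open>lambda_compose scale t s (act a) (act b v)\<close> and
  \<open>[a\<^sub>s b]\<^sub>t v\<close> is \<open>lambda_compose scale s t (\<lambda>d. act d v) (bracket a b)\<close>.\<close>

definition lambda_compose ::
    "(complex poly \<Rightarrow> 'v::ab_group_add \<Rightarrow> 'v) \<Rightarrow> complex poly poly \<Rightarrow> complex poly poly \<Rightarrow>
     ('a::zero \<Rightarrow> 'v poly) \<Rightarrow> 'a poly \<Rightarrow> 'v poly poly" where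
  "lambda_compose scale s t f q =
     (\<Sum>k\<le>degree q. \<Sum>j\<le>degree (f (coeff q k)).
        map_poly (map_poly (\<lambda>c. scale [:c:] (coeff (f (coeff q k)) j))) (s ^ k * t ^ j))"

locale lie_conformal_algebra = module scale
  for scale :: "complex poly \<Rightarrow> 'a::ab_group_add \<Rightarrow> 'a" +
  fixes R :: "'a set"
    and bracket :: "'a \<Rightarrow> 'a \<Rightarrow> 'a poly"
  assumes subspace_carrier: "subspace R"
    and bracket_closed: "a \<in> R \<Longrightarrow> b \<in> R \<Longrightarrow> coeff (bracket a b) n \<in> R"
    and bracket_add_left:
      "a \<in> R \<Longrightarrow> a' \<in> R \<Longrightarrow> b \<in> R \<Longrightarrow> bracket (a + a') b = bracket a b + bracket a' b"
    and bracket_add_right: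
      "a \<in> R \<Longrightarrow> b \<in> R \<Longrightarrow> b' \<in> R \<Longrightarrow> bracket a (b + b') = bracket a b + bracket a b'"
    and bracket_cscale_left:
      "a \<in> R \<Longrightarrow> b \<in> R \<Longrightarrow> bracket (scale [:z:] a) b = map_poly (scale [:z:]) (bracket a b)"
    and bracket_cscale_right:
      "a \<in> R \<Longrightarrow> b \<in> R \<Longrightarrow> bracket a (scale [:z:] b) = map_poly (scale [:z:]) (bracket a b)"
    and bracket_D_left:
      "a \<in> R \<Longrightarrow> b \<in> R \<Longrightarrow> bracket (scale [:0, 1:] a) b = - pCons 0 (bracket a b)"
    and bracket_D_right:
      "a \<in> R \<Longrightarrow> b \<in> R \<Longrightarrow>
        bracket a (scale [:0, 1:] b) =
          pCons 0 (bracket a b) + map_poly (scale [:0, 1:]) (bracket a b)"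
    and skew_symmetry:
      "a \<in> R \<Longrightarrow> b \<in> R \<Longrightarrow>
        bracket a b = - lambda_subst scale (- outer_var - inner_var) (bracket b a)"
    and jacobi:
      "a \<in> R \<Longrightarrow> b \<in> R \<Longrightarrow> c \<in> R \<Longrightarrow>
        lambda_compose scale outer_var inner_var (bracket a) (bracket b c) =
          lambda_compose scale inner_var (inner_var + outer_var) (\<lambda>d. bracket d c) (bracket a b)
          + lambda_compose scale inner_var outer_var (bracket b) (bracket a c)"

locale conformal_module =
  alg: lie_conformal_algebra scaleR R bracket + module scaleV
  for scaleR :: "complex poly \<Rightarrow> 'a::ab_group_add \<Rightarrow> 'a"
    and R :: "'a set"
    and bracket :: "'a \<Rightarrow> 'a \<Rightarrow> 'a poly"
    and scaleV :: "complex poly \<Rightarrow> 'v::ab_group_add \<Rightarrow> 'v" +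
  fixes V :: "'v set"
    and act :: "'a \<Rightarrow> 'v \<Rightarrow> 'v poly"
  assumes subspace_V: "subspace V"
    and act_closed: "a \<in> R \<Longrightarrow> v \<in> V \<Longrightarrow> coeff (act a v) n \<in> V"
    and act_add_left:
      "a \<in> R \<Longrightarrow> a' \<in> R \<Longrightarrow> v \<in> V \<Longrightarrow> act (a + a') v = act a v + act a' v"
    and act_add_right:
      "a \<in> R \<Longrightarrow> v \<in> V \<Longrightarrow> v' \<in> V \<Longrightarrow> act a (v + v') = act a v + act a v'"
    and act_cscale_left:
      "a \<in> R \<Longrightarrow> v \<in> V \<Longrightarrow> act (scaleR [:z:] a) v = map_poly (scaleV [:z:]) (act a v)"
    and act_cscale_right:
      "a \<in> R \<Longrightarrow> v \<in> V \<Longrightarrow> act a (scaleV [:z:] v) = map_poly (scaleV [:z:]) (act a v)"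
    and act_D_left:
      "a \<in> R \<Longrightarrow> v \<in> V \<Longrightarrow> act (scaleR [:0, 1:] a) v = - pCons 0 (act a v)"
    and act_D_right:
      "a \<in> R \<Longrightarrow> v \<in> V \<Longrightarrow>
        act a (scaleV [:0, 1:] v) =
          map_poly (scaleV [:0, 1:]) (act a v) + pCons 0 (act a v)"
    and act_bracket:
      "a \<in> R \<Longrightarrow> b \<in> R \<Longrightarrow> v \<in> V \<Longrightarrow>
        lambda_compose scaleV inner_var (inner_var + outer_var) (\<lambda>d. act d v) (bracket a b) =
          lambda_compose scaleV outer_var inner_var (act a) (act b v)
          - lambda_compose scaleV inner_var outer_var (act b) (act a v)"

definition nontrivial_action :: "'a set \<Rightarrow> 'v set \<Rightarrow> ('a \<Rightarrow> 'v::zero \<Rightarrow> 'v poly) \<Rightarrow> bool" where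
  "nontrivial_action R V act \<longleftrightarrow> (\<exists>a\<in>R. \<exists>v\<in>V. act a v \<noteq> 0)"

definition conformal_modules_isomorphic ::
    "'a set \<Rightarrow>
     (complex poly \<Rightarrow> 'v::ab_group_add \<Rightarrow> 'v) \<Rightarrow> 'v set \<Rightarrow> ('a \<Rightarrow> 'v \<Rightarrow> 'v poly) \<Rightarrow>
     (complex poly \<Rightarrow> 'w::ab_group_add \<Rightarrow> 'w) \<Rightarrow> 'w set \<Rightarrow> ('a \<Rightarrow> 'w \<Rightarrow> 'w poly) \<Rightarrow> bool" where
  "conformal_modules_isomorphic R scaleV V actV scaleW W actW \<longleftrightarrow>
     (\<exists>f. bij_betw f V W
        \<and> (\<forall>u\<in>V. \<forall>v\<in>V. f (u + v) = f u + f v)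
        \<and> (\<forall>p. \<forall>v\<in>V. f (scaleV p v) = scaleW p (f v))
        \<and> (\<forall>a\<in>R. \<forall>v\<in>V. actW a (f v) = map_poly f (actV a v)))"

definition internal_direct_sum :: "'i set \<Rightarrow> 'v::ab_group_add set \<Rightarrow> ('i \<Rightarrow> 'v set) \<Rightarrow> bool" where
  "internal_direct_sum I V W \<longleftrightarrow>
     (\<forall>i\<in>I. W i \<subseteq> V) \<and>
     (\<forall>v\<in>V. \<exists>!u. (\<forall>i\<in>I. u i \<in> W i) \<and> (\<forall>i. i \<notin> I \<longrightarrow> u i = 0) \<and>
        finite {i. u i \<noteq> 0} \<and> v = (\<Sum>i | u i \<noteq> 0. u i))"


section \<open>The free modules and the algebra \<open>CL(b, \<phi>)\<close>\<close>

definition additive_subgroup_of_complex :: "complex set \<Rightarrow> bool" where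
  "additive_subgroup_of_complex \<Delta> \<longleftrightarrow>
     0 \<in> \<Delta> \<and> (\<forall>\<alpha>\<in>\<Delta>. \<forall>\<beta>\<in>\<Delta>. \<alpha> + \<beta> \<in> \<Delta>) \<and> (\<forall>\<alpha>\<in>\<Delta>. - \<alpha> \<in> \<Delta>)"

definition additive_hom_on :: "complex set \<Rightarrow> (complex \<Rightarrow> complex) \<Rightarrow> bool" where
  "additive_hom_on \<Delta> \<phi> \<longleftrightarrow> (\<forall>\<alpha>\<in>\<Delta>. \<forall>\<beta>\<in>\<Delta>. \<phi> (\<alpha> + \<beta>) = \<phi> \<alpha> + \<phi> \<beta>)"

text \<open>The free \<open>\<complex>[\<partial>]\<close>-module with basis indexed by \<open>\<Delta>\<close>; the basis element with index \<open>\<alpha>\<close> is \<open>gen \<alpha>\<close>.\<close>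

type_synonym free_elem = "complex \<Rightarrow>\<^sub>0 complex poly"

definition free_carrier :: "complex set \<Rightarrow> free_elem set" where
  "free_carrier \<Delta> = {f. Poly_Mapping.keys f \<subseteq> \<Delta>}"

definition free_scale :: "complex poly \<Rightarrow> free_elem \<Rightarrow> free_elem" where
  "free_scale p f = Poly_Mapping.map (\<lambda>q. p * q) f"

definition gen :: "complex \<Rightarrow> free_elem" where
  "gen \<alpha> = Poly_Mapping.single \<alpha> 1"

text \<open>\<open>poly_at p s\<close> is \<open>p(s)\<close> for \<open>p \<in> \<complex>[x]\<close> and \<open>s\<close> in a polynomial ring in two variables.\<close>

definition poly_at :: "complex poly \<Rightarrow> complex poly poly \<Rightarrow> complex poly poly" where
  "poly_at p s = poly (map_poly cst p) s"

text \<open>The only extension of \<open>(x\<^sub>\<beta>)\<^sub>\<lambda> M\<^sub>\<gamma> = P \<beta> \<gamma>(\<partial>, \<lambda>) M\<^bsub>\<beta>+\<gamma>\<^esub>\<close> that is compatible with \<open>\<partial>\<close>: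
  \<open>(f(\<partial>) x\<^sub>\<beta>)\<^sub>\<lambda> (g(\<partial>) M\<^sub>\<gamma>) = f(-\<lambda>) g(\<partial> + \<lambda>) P \<beta> \<gamma>(\<partial>, \<lambda>) M\<^bsub>\<beta>+\<gamma>\<^esub>\<close>.\<close>

definition sesqui_extend ::
    "(complex \<Rightarrow> complex \<Rightarrow> complex poly poly) \<Rightarrow> free_elem \<Rightarrow> free_elem \<Rightarrow> free_elem poly" where
  "sesqui_extend P f g =
     (\<Sum>\<beta>\<in>Poly_Mapping.keys f. \<Sum>\<gamma>\<in>Poly_Mapping.keys g.
        map_poly (Poly_Mapping.single (\<beta> + \<gamma>))
          (poly_at (Poly_Mapping.lookup f \<beta>) (- outer_var) * poly_at (Poly_Mapping.lookup g \<gamma>) (inner_var + outer_var)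
            * P \<beta> \<gamma>))"

text \<open>In all structure polynomials below, the inner variable is \<open>\<partial>\<close> and the outer variable is \<open>\<lambda>\<close>.\<close>

definition CL_coeff ::
    "complex \<Rightarrow> (complex \<Rightarrow> complex) \<Rightarrow> complex \<Rightarrow> complex \<Rightarrow> complex poly poly" where
  "CL_coeff b \<phi> \<alpha> \<beta> =
     cst (\<alpha> + b) * inner_var + cst (\<alpha> + \<beta> + 2 * b) * outer_var
     + cst ((1 / b) * (\<phi> \<alpha> * \<beta> - \<phi> \<beta> * \<alpha> + b * (\<phi> \<alpha> - \<phi> \<beta>)))"

definition CL_bracket ::
    "complex \<Rightarrow> (complex \<Rightarrow> complex) \<Rightarrow> free_elem \<Rightarrow> free_elem \<Rightarrow> free_elem poly" where
  "CL_bracket b \<phi> = sesqui_extend (CL_coeff b \<phi>)"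

abbreviation CL_module ::
    "complex set \<Rightarrow> complex \<Rightarrow> (complex \<Rightarrow> complex) \<Rightarrow>
     (complex poly \<Rightarrow> 'v::ab_group_add \<Rightarrow> 'v) \<Rightarrow> 'v set \<Rightarrow> (free_elem \<Rightarrow> 'v \<Rightarrow> 'v poly) \<Rightarrow> bool" where
  "CL_module \<Delta> b \<phi> \<equiv> conformal_module free_scale (free_carrier \<Delta>) (CL_bracket b \<phi>)"

definition graded_CL_module ::
    "complex set \<Rightarrow> complex \<Rightarrow> (complex \<Rightarrow> complex) \<Rightarrow>
     (complex poly \<Rightarrow> 'v::ab_group_add \<Rightarrow> 'v) \<Rightarrow> 'v set \<Rightarrow> (free_elem \<Rightarrow> 'v \<Rightarrow> 'v poly) \<Rightarrow>
     (complex \<Rightarrow> 'v set) \<Rightarrow> bool" where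
  "graded_CL_module \<Delta> b \<phi> scale V act W \<longleftrightarrow>
     CL_module \<Delta> b \<phi> scale V act \<and>
     (\<forall>\<alpha>\<in>\<Delta>. module.subspace scale (W \<alpha>)) \<and>
     internal_direct_sum \<Delta> V W \<and>
     (\<forall>\<alpha>\<in>\<Delta>. \<forall>\<beta>\<in>\<Delta>. \<forall>v\<in>W \<beta>. \<forall>n. coeff (act (gen \<alpha>) v) n \<in> W (\<alpha> + \<beta>))"

definition free_intermediate_series ::
    "complex set \<Rightarrow> (complex poly \<Rightarrow> 'v::ab_group_add \<Rightarrow> 'v) \<Rightarrow> (complex \<Rightarrow> 'v set) \<Rightarrow> bool" where
  "free_intermediate_series \<Delta> scale W \<longleftrightarrow>
     (\<forall>\<alpha>\<in>\<Delta>. \<exists>m. \<not> module.dependent scale {m} \<and> module.span scale {m} = W \<alpha>)"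


section \<open>The modules \<open>V\<^sub>c\<^sub>,\<^sub>e\<close>, \<open>V\<^sub>A\<^sub>1\<^sub>,\<^sub>c\<close> and \<open>V\<^sub>A\<^sub>2\<^sub>,\<^sub>c\<close>\<close>

definition Vce_coeff ::
    "complex \<Rightarrow> (complex \<Rightarrow> complex) \<Rightarrow> complex \<Rightarrow> complex \<Rightarrow> complex \<Rightarrow> complex \<Rightarrow> complex poly poly" where
  "Vce_coeff b \<phi> c e \<beta> \<gamma> =
     cst (\<beta> + b) *
       (cst (c - \<phi> (\<beta> + \<gamma>) / b + \<phi> \<beta> / (\<beta> + b) * (e + (\<beta> + \<gamma>) / b))
        + cst (b / (\<beta> + b) * (e + (\<beta> + \<gamma>) / b)) * outer_var
        + inner_var)"

definition sequence_A1 :: "complex set \<Rightarrow> complex \<Rightarrow> (complex \<Rightarrow> complex) \<Rightarrow> bool" where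
  "sequence_A1 \<Delta> b q \<longleftrightarrow>
     (\<exists>\<gamma>0\<in>\<Delta>. q \<gamma>0 = 0 \<and> (\<forall>\<alpha>\<in>\<Delta>. \<alpha> \<noteq> 0 \<longrightarrow> q (\<alpha> + \<gamma>0) = 1 + \<alpha> / b))"

definition sequence_A2 :: "complex set \<Rightarrow> complex \<Rightarrow> (complex \<Rightarrow> complex) \<Rightarrow> bool" where
  "sequence_A2 \<Delta> b q \<longleftrightarrow>
     (\<exists>\<gamma>0\<in>\<Delta>. q \<gamma>0 = 1 \<and> (\<forall>\<beta>\<in>\<Delta>. \<beta> \<noteq> 0 \<longrightarrow> q (\<beta> + \<gamma>0) = \<beta> / b))"

definition generic_coeff ::
    "complex \<Rightarrow> (complex \<Rightarrow> complex) \<Rightarrow> (complex \<Rightarrow> complex) \<Rightarrow> complex \<Rightarrow> complex \<Rightarrow> complex \<Rightarrow>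
     complex poly poly" where
  "generic_coeff b \<phi> q c \<beta> \<gamma> =
     cst (\<beta> + b) *
       (inner_var + cst (b / (\<beta> + b) * q (\<beta> + \<gamma>)) * outer_var
        + cst (\<phi> \<beta> / (\<beta> + b) * q (\<beta> + \<gamma>) + c - \<phi> (\<beta> + \<gamma>) / b))"

definition VA1_coeff ::
    "complex \<Rightarrow> (complex \<Rightarrow> complex) \<Rightarrow> (complex \<Rightarrow> complex) \<Rightarrow> complex \<Rightarrow> complex \<Rightarrow> complex \<Rightarrow>
     complex poly poly" where
  "VA1_coeff b \<phi> q c \<beta> \<gamma> =
     (if \<beta> \<noteq> 0 \<and> q (\<beta> + \<gamma>) = 0 \<and> q \<gamma> = 1 - \<beta> / b then
        cst (\<beta> + b) * (inner_var + cst (c - \<phi> (\<beta> + \<gamma>) / b))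
          * (inner_var + cst (b / (\<beta> + b)) * outer_var
             + cst (c - \<phi> (\<beta> + \<gamma>) / b + \<phi> \<beta> / (\<beta> + b)))
      else if \<beta> \<noteq> 0 \<and> q \<gamma> = 0 \<and> q (\<beta> + \<gamma>) = 1 + \<beta> / b then
        cst (\<beta> + b)
      else generic_coeff b \<phi> q c \<beta> \<gamma>)"

definition VA2_coeff ::
    "complex \<Rightarrow> (complex \<Rightarrow> complex) \<Rightarrow> (complex \<Rightarrow> complex) \<Rightarrow> complex \<Rightarrow> complex \<Rightarrow> complex \<Rightarrow>
     complex poly poly" where
  "VA2_coeff b \<phi> q c \<beta> \<gamma> =
     (if \<beta> \<noteq> 0 \<and> q (\<beta> + \<gamma>) = 1 \<and> q \<gamma> = - (\<beta> / b) then
        cst (\<beta> + b)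
      else if \<beta> \<noteq> 0 \<and> q (\<beta> + \<gamma>) = \<beta> / b \<and> q \<gamma> = 1 then
        cst (\<beta> + b) *
          ((inner_var + cst (c - \<phi> (\<beta> + \<gamma>) / b))
             * (inner_var + cst ((2 * \<beta> + b) / (\<beta> + b)) * outer_var
                + cst (c - \<phi> (\<beta> + \<gamma>) / b + (2 * \<beta> + b) * \<phi> \<beta> / (b * (\<beta> + b))))
           + cst (\<beta> / (\<beta> + b)) * (outer_var + cst (\<phi> \<beta> / b)) ^ 2)
      else generic_coeff b \<phi> q c \<beta> \<gamma>)"

text \<open>Each model has scalar action \<open>free_scale\<close>, carrier \<open>free_carrier \<Delta>\<close> and generators
  \<open>M\<^sub>\<gamma> = gen \<gamma>\<close>; only the \<open>\<lambda>\<close>-action differs.\<close>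

definition Vce_act ::
    "complex \<Rightarrow> (complex \<Rightarrow> complex) \<Rightarrow> complex \<Rightarrow> complex \<Rightarrow> free_elem \<Rightarrow> free_elem \<Rightarrow> free_elem poly" where
  "Vce_act b \<phi> c e = sesqui_extend (Vce_coeff b \<phi> c e)"

definition VA1_act ::
    "complex \<Rightarrow> (complex \<Rightarrow> complex) \<Rightarrow> (complex \<Rightarrow> complex) \<Rightarrow> complex \<Rightarrow>
     free_elem \<Rightarrow> free_elem \<Rightarrow> free_elem poly" where
  "VA1_act b \<phi> q c = sesqui_extend (VA1_coeff b \<phi> q c)"

definition VA2_act ::
    "complex \<Rightarrow> (complex \<Rightarrow> complex) \<Rightarrow> (complex \<Rightarrow> complex) \<Rightarrow> complex \<Rightarrow>
     free_elem \<Rightarrow> free_elem \<Rightarrow> free_elem poly" where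
  "VA2_act b \<phi> q c = sesqui_extend (VA2_coeff b \<phi> q c)"

section \<open>\<open>CL(b, \<phi>)\<close> is a Lie conformal algebra\<close>

lemma lookup_free_scale [simp]:
  "Poly_Mapping.lookup (free_scale p f) \<alpha> = p * Poly_Mapping.lookup f \<alpha>"
  by (auto simp: free_scale_def map.rep_eq when_def)

lemma module_free_scale: "module free_scale"
  by standard (auto intro!: poly_mapping_eqI simp: lookup_add algebra_simps)

text \<open>The identities between polynomials are checked by evaluating \<open>\<partial>\<close>, \<open>\<lambda>\<close>, \<open>\<mu>\<close> at complex numbers
  \<open>d\<close>, \<open>l\<close>, \<open>m\<close> and taking the coefficient of the basis element with index \<open>\<epsilon>\<close>.\<close>

definition ev_poly :: "complex poly poly \<Rightarrow> complex \<Rightarrow> complex \<Rightarrow> complex" where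
  "ev_poly P d l = poly (poly P [:l:]) d"

definition ev_free :: "complex \<Rightarrow> complex \<Rightarrow> complex \<Rightarrow> free_elem poly \<Rightarrow> complex" where
  "ev_free \<epsilon> d l q = poly (map_poly (\<lambda>m. poly (Poly_Mapping.lookup m \<epsilon>) d) q) l"

definition ev_free2 :: "complex \<Rightarrow> complex \<Rightarrow> complex \<Rightarrow> complex \<Rightarrow> free_elem poly poly \<Rightarrow> complex" where
  "ev_free2 \<epsilon> d l m X = poly (map_poly (ev_free \<epsilon> d l) X) m"

lemma map_poly_add:
  assumes "f 0 = 0" "\<And>x y. f (x + y) = f x + f y"
  shows "map_poly f (p + q) = map_poly f p + map_poly f q"
  by (intro poly_eqI) (simp add: coeff_map_poly assms)

lemma ev_poly_simps [simp]:
  "ev_poly (P + Q) d l = ev_poly P d l + ev_poly Q d l"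
  "ev_poly (P - Q) d l = ev_poly P d l - ev_poly Q d l"
  "ev_poly (- P) d l = - ev_poly P d l"
  "ev_poly (P * Q) d l = ev_poly P d l * ev_poly Q d l"
  "ev_poly (P ^ n) d l = ev_poly P d l ^ n"
  "ev_poly 0 d l = 0"
  "ev_poly (cst c) d l = c"
  "ev_poly inner_var d l = d"
  "ev_poly outer_var d l = l"
  by (simp_all add: ev_poly_def cst_def inner_var_def outer_var_def)

lemma ev_poly_alt: "ev_poly P d l = poly (map_poly (\<lambda>p. poly p d) P) l"
  by (induction P) (simp_all add: ev_poly_def map_poly_pCons)

lemma ev_poly_poly_at [simp]: "ev_poly (poly_at p s) d l = poly p (ev_poly s d l)"
  by (induction p) (simp_all add: poly_at_def map_poly_pCons cst_def[of 0])

lemma ev_free_pCons [simp]: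
  "ev_free \<epsilon> d l (pCons x q) = poly (Poly_Mapping.lookup x \<epsilon>) d + l * ev_free \<epsilon> d l q"
  by (simp add: ev_free_def map_poly_pCons)

lemma ev_free_0 [simp]: "ev_free \<epsilon> d l 0 = 0"
  by (simp add: ev_free_def)

lemma ev_free_add [simp]: "ev_free \<epsilon> d l (p + q) = ev_free \<epsilon> d l p + ev_free \<epsilon> d l q"
  by (simp add: ev_free_def map_poly_add lookup_add)

lemma ev_free_minus [simp]: "ev_free \<epsilon> d l (- p) = - ev_free \<epsilon> d l p"
  using ev_free_add[of \<epsilon> d l p "- p"] by (simp add: add_eq_0_iff)

lemma ev_free_sum: "ev_free \<epsilon> d l (sum g A) = (\<Sum>x\<in>A. ev_free \<epsilon> d l (g x))"
  by (induction A rule: infinite_finite_induct) auto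

lemma ev_free_scale:
  "ev_free \<epsilon> d l (map_poly (free_scale p) q) = poly p d * ev_free \<epsilon> d l q"
proof -
  interpret module free_scale by (rule module_free_scale)
  show ?thesis by (induction q) (simp_all add: map_poly_pCons algebra_simps)
qed

lemma ev_free_altdef:
  assumes "degree q \<le> N"
  shows "ev_free \<epsilon> d l q = (\<Sum>n\<le>N. l ^ n * poly (Poly_Mapping.lookup (coeff q n) \<epsilon>) d)"
proof -
  have "degree (map_poly (\<lambda>m. poly (Poly_Mapping.lookup m \<epsilon>) d) q) \<le> N"
    using assms by (intro degree_le) (auto simp: coeff_map_poly coeff_eq_0)
  then show ?thesis
    unfolding ev_free_def poly_altdef
    by (subst sum.mono_neutral_left[of "{..N}"]) (auto simp: coeff_map_poly coeff_eq_0 mult.commute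
          intro!: sum.cong)
qed

lemma ev_free_single:
  "ev_free \<epsilon> d l (map_poly (Poly_Mapping.single \<alpha>) P) = (if \<alpha> = \<epsilon> then ev_poly P d l else 0)"
  by (induction P) (auto simp: map_poly_pCons lookup_single when_def ev_poly_alt)

lemma poly_eqI_infinite:
  fixes p q :: "complex poly"
  assumes "\<And>x. poly p x = poly q x"
  shows "p = q"
  using assms by (simp add: poly_eq_poly_eq_iff[symmetric] fun_eq_iff)

lemma ev_free_eqI:
  assumes "\<And>\<epsilon> d l. ev_free \<epsilon> d l q = ev_free \<epsilon> d l r"
  shows "q = r"
proof (rule poly_eqI, rule poly_mapping_eqI, rule poly_eqI_infinite)
  fix n \<epsilon> d
  have "map_poly (\<lambda>m. poly (Poly_Mapping.lookup m \<epsilon>) d) q =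
        map_poly (\<lambda>m. poly (Poly_Mapping.lookup m \<epsilon>) d) r"
    using assms by (intro poly_eqI_infinite) (simp add: ev_free_def)
  from arg_cong[OF this, of "\<lambda>p. coeff p n"]
  show "poly (Poly_Mapping.lookup (coeff q n) \<epsilon>) d = poly (Poly_Mapping.lookup (coeff r n) \<epsilon>) d"
    by (simp add: coeff_map_poly)
qed

lemma ev_free2_add [simp]: "ev_free2 \<epsilon> d l m (X + Y) = ev_free2 \<epsilon> d l m X + ev_free2 \<epsilon> d l m Y"
  by (simp add: ev_free2_def map_poly_add)

lemma ev_free2_0 [simp]: "ev_free2 \<epsilon> d l m 0 = 0"
  by (simp add: ev_free2_def)

lemma ev_free2_sum: "ev_free2 \<epsilon> d l m (sum g A) = (\<Sum>x\<in>A. ev_free2 \<epsilon> d l m (g x))"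
  by (induction A rule: infinite_finite_induct) auto

lemma ev_free2_eqI:
  assumes "\<And>\<epsilon> d l m. ev_free2 \<epsilon> d l m X = ev_free2 \<epsilon> d l m Y"
  shows "X = Y"
proof (rule poly_eqI, rule ev_free_eqI)
  fix n \<epsilon> d l
  have "map_poly (ev_free \<epsilon> d l) X = map_poly (ev_free \<epsilon> d l) Y"
    using assms by (intro poly_eqI_infinite) (simp add: ev_free2_def)
  from arg_cong[OF this, of "\<lambda>p. coeff p n"]
  show "ev_free \<epsilon> d l (coeff X n) = ev_free \<epsilon> d l (coeff Y n)"
    by (simp add: coeff_map_poly)
qed

lemma ev_lambda_subst:
  "ev_free \<epsilon> d l (lambda_subst free_scale s q) = ev_free \<epsilon> d (ev_poly s d l) q"
proof -
  interpret module free_scale by (rule module_free_scale)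
  have "ev_free \<epsilon> d l (map_poly (\<lambda>p. free_scale p x) P) =
      ev_poly P d l * poly (Poly_Mapping.lookup x \<epsilon>) d" for P x
    by (induction P) (simp_all add: map_poly_pCons ev_poly_alt algebra_simps)
  then show ?thesis
    by (simp add: lambda_subst_def ev_free_sum ev_free_altdef[OF order_refl, of \<epsilon> d _ q])
qed

lemma ev_lambda_compose:
  fixes q :: "free_elem poly"
  shows "ev_free2 \<epsilon> d l m (lambda_compose free_scale s t f q) =
    (\<Sum>k\<le>degree q. ev_poly s l m ^ k * ev_free \<epsilon> d (ev_poly t l m) (f (coeff q k)))"
proof -
  interpret module free_scale by (rule module_free_scale)
  have cs: "ev_free \<epsilon> d l (map_poly (\<lambda>c. free_scale [:c:] x) p) =
      poly p l * poly (Poly_Mapping.lookup x \<epsilon>) d" for p x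
    by (induction p) (simp_all add: map_poly_pCons algebra_simps)
  have "ev_free2 \<epsilon> d l m (map_poly (map_poly (\<lambda>c. free_scale [:c:] x)) P) =
      ev_poly P l m * poly (Poly_Mapping.lookup x \<epsilon>) d" for P x
    by (induction P) (simp_all add: map_poly_pCons ev_free2_def cs ev_poly_alt algebra_simps)
  then show ?thesis
    by (simp add: lambda_compose_def ev_free2_sum ev_free_altdef[OF order_refl, of \<epsilon> d "ev_poly t l m"]
          sum_distrib_left mult.assoc)
qed

lemma ev_sesqui_extend:
  assumes "finite S" "finite T" "Poly_Mapping.keys f \<subseteq> S" "Poly_Mapping.keys g \<subseteq> T"
  shows "ev_free \<epsilon> d l (sesqui_extend P f g) =
    (\<Sum>\<beta>\<in>S. \<Sum>\<gamma>\<in>T. if \<beta> + \<gamma> = \<epsilon>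
       then poly (Poly_Mapping.lookup f \<beta>) (- l) * poly (Poly_Mapping.lookup g \<gamma>) (d + l) * ev_poly (P \<beta> \<gamma>) d l
       else 0)"
proof -
  have "ev_free \<epsilon> d l (sesqui_extend P f g) =
    (\<Sum>\<beta>\<in>Poly_Mapping.keys f. \<Sum>\<gamma>\<in>Poly_Mapping.keys g. if \<beta> + \<gamma> = \<epsilon>
       then poly (Poly_Mapping.lookup f \<beta>) (- l) * poly (Poly_Mapping.lookup g \<gamma>) (d + l) * ev_poly (P \<beta> \<gamma>) d l
       else 0)" (is "_ = (\<Sum>\<beta>\<in>_. \<Sum>\<gamma>\<in>_. ?t \<beta> \<gamma>)")
    by (simp add: sesqui_extend_def ev_free_sum ev_free_single cong: if_cong)
  also have "\<dots> = (\<Sum>\<beta>\<in>Poly_Mapping.keys f. \<Sum>\<gamma>\<in>T. ?t \<beta> \<gamma>)"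
    using assms by (intro sum.cong refl sum.mono_neutral_left) (auto simp: in_keys_iff)
  also have "\<dots> = (\<Sum>\<beta>\<in>S. \<Sum>\<gamma>\<in>T. ?t \<beta> \<gamma>)"
    using assms by (intro sum.mono_neutral_left) (auto simp: in_keys_iff intro!: sum.neutral)
  finally show ?thesis .
qed

lemma keys_coeff_sesqui_extend:
  "Poly_Mapping.keys (coeff (sesqui_extend P f g) n) \<subseteq>
     (\<lambda>(\<beta>, \<gamma>). \<beta> + \<gamma>) ` (Poly_Mapping.keys f \<times> Poly_Mapping.keys g)"
proof
  fix \<delta> assume \<delta>: "\<delta> \<in> Poly_Mapping.keys (coeff (sesqui_extend P f g) n)"
  show "\<delta> \<in> (\<lambda>(\<beta>, \<gamma>). \<beta> + \<gamma>) ` (Poly_Mapping.keys f \<times> Poly_Mapping.keys g)"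
  proof (rule ccontr)
    assume "\<not> ?thesis"
    then have "Poly_Mapping.lookup (coeff (sesqui_extend P f g) n) \<delta> = 0"
      by (force simp: sesqui_extend_def coeff_sum lookup_sum coeff_map_poly lookup_single when_def
            intro!: sum.neutral)
    with \<delta> show False by (simp add: in_keys_iff)
  qed
qed

lemma ev_sum_coeff:
  "(\<Sum>k\<le>degree q. s ^ k * poly (Poly_Mapping.lookup (coeff q k) \<delta>) d) = ev_free \<delta> d s q"
  by (simp add: ev_free_altdef[OF order_refl])

text \<open>The evaluation of \<open>a\<^sub>t(b\<^sub>s v)\<close> for \<open>s, t \<in> \<complex>[\<lambda>][\<mu>]\<close>.\<close>

lemma ev_act_act:
  fixes a b v :: free_elem and s t :: "complex poly poly" and l m :: complex
  defines "A \<equiv> Poly_Mapping.keys a" and "B \<equiv> Poly_Mapping.keys b" and "C \<equiv> Poly_Mapping.keys v"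
  defines "s' \<equiv> ev_poly s l m" and "t' \<equiv> ev_poly t l m"
  shows "ev_free2 \<epsilon> d l m (lambda_compose free_scale s t (sesqui_extend P a) (sesqui_extend Q b v)) =
    (\<Sum>\<alpha>\<in>A. \<Sum>\<beta>\<in>B. \<Sum>\<gamma>\<in>C. if \<alpha> + \<beta> + \<gamma> = \<epsilon> then
        poly (Poly_Mapping.lookup a \<alpha>) (- t') * poly (Poly_Mapping.lookup b \<beta>) (- s')
        * poly (Poly_Mapping.lookup v \<gamma>) (d + t' + s')
        * ev_poly (Q \<beta> \<gamma>) (d + t') s' * ev_poly (P \<alpha> (\<beta> + \<gamma>)) d t' else 0)"
proof -
  define T where "T = (\<lambda>(\<beta>, \<gamma>). \<beta> + \<gamma>) ` (B \<times> C)"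
  have T: "finite T" by (simp add: T_def B_def C_def)
  have inT: "\<beta> \<in> B \<Longrightarrow> \<gamma> \<in> C \<Longrightarrow> \<beta> + \<gamma> \<in> T" for \<beta> \<gamma> by (auto simp: T_def)
  let ?q = "sesqui_extend Q b v"
  let ?a = "\<lambda>\<alpha>. poly (Poly_Mapping.lookup a \<alpha>) (- t')"
  have kq: "Poly_Mapping.keys (coeff ?q k) \<subseteq> T" for k
    unfolding T_def B_def C_def by (rule keys_coeff_sesqui_extend)
  have "ev_free2 \<epsilon> d l m (lambda_compose free_scale s t (sesqui_extend P a) ?q) =
     (\<Sum>k\<le>degree ?q. s' ^ k * ev_free \<epsilon> d t' (sesqui_extend P a (coeff ?q k)))"
    by (simp add: ev_lambda_compose s'_def t'_def)
  also have "\<dots> = (\<Sum>k\<le>degree ?q. s' ^ k * (\<Sum>\<alpha>\<in>A. \<Sum>\<delta>\<in>T. if \<alpha> + \<delta> = \<epsilon> then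
       ?a \<alpha> * poly (Poly_Mapping.lookup (coeff ?q k) \<delta>) (d + t') * ev_poly (P \<alpha> \<delta>) d t' else 0))"
    by (subst ev_sesqui_extend[OF _ T _ kq, of A]) (simp_all add: A_def)
  also have "\<dots> = (\<Sum>k\<le>degree ?q. \<Sum>\<alpha>\<in>A. \<Sum>\<delta>\<in>T. if \<alpha> + \<delta> = \<epsilon> then
       ?a \<alpha> * (s' ^ k * poly (Poly_Mapping.lookup (coeff ?q k) \<delta>) (d + t')) * ev_poly (P \<alpha> \<delta>) d t' else 0)"
    by (simp add: sum_distrib_left if_distrib mult_ac cong: if_cong)
  also have "\<dots> = (\<Sum>\<alpha>\<in>A. \<Sum>\<delta>\<in>T. \<Sum>k\<le>degree ?q. if \<alpha> + \<delta> = \<epsilon> then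
       ?a \<alpha> * (s' ^ k * poly (Poly_Mapping.lookup (coeff ?q k) \<delta>) (d + t')) * ev_poly (P \<alpha> \<delta>) d t' else 0)"
    by (subst sum.swap, rule sum.cong[OF refl], subst sum.swap) simp
  also have "\<dots> = (\<Sum>\<alpha>\<in>A. \<Sum>\<delta>\<in>T. if \<alpha> + \<delta> = \<epsilon> then
       ?a \<alpha> * ev_free \<delta> (d + t') s' ?q * ev_poly (P \<alpha> \<delta>) d t' else 0)"
    by (intro sum.cong refl)
      (simp add: ev_sum_coeff[symmetric] sum_distrib_left sum_distrib_right)
  also have "\<dots> = (\<Sum>\<alpha>\<in>A. \<Sum>\<delta>\<in>T. \<Sum>\<beta>\<in>B. \<Sum>\<gamma>\<in>C. if \<delta> = \<beta> + \<gamma> then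
      (if \<alpha> + \<beta> + \<gamma> = \<epsilon> then ?a \<alpha> * poly (Poly_Mapping.lookup b \<beta>) (- s')
        * poly (Poly_Mapping.lookup v \<gamma>) (d + t' + s')
        * ev_poly (Q \<beta> \<gamma>) (d + t') s' * ev_poly (P \<alpha> (\<beta> + \<gamma>)) d t' else 0) else 0)"
    (is "_ = (\<Sum>\<alpha>\<in>A. \<Sum>\<delta>\<in>T. \<Sum>\<beta>\<in>B. \<Sum>\<gamma>\<in>C. if _ then ?r \<alpha> \<beta> \<gamma> else 0)")
    by (intro sum.cong refl, subst ev_sesqui_extend[of B C])
      (auto simp: B_def C_def sum_distrib_left sum_distrib_right add.assoc mult_ac intro!: sum.cong sum.neutral)
  also have "\<dots> = (\<Sum>\<alpha>\<in>A. \<Sum>\<beta>\<in>B. \<Sum>\<gamma>\<in>C. \<Sum>\<delta>\<in>T. if \<delta> = \<beta> + \<gamma> then ?r \<alpha> \<beta> \<gamma> else 0)"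
    by (rule sum.cong[OF refl], subst sum.swap, rule sum.cong[OF refl], rule sum.swap)
  also have "\<dots> = (\<Sum>\<alpha>\<in>A. \<Sum>\<beta>\<in>B. \<Sum>\<gamma>\<in>C. ?r \<alpha> \<beta> \<gamma>)"
    using T inT by (intro sum.cong refl) (simp add: sum.delta)
  finally show ?thesis .
qed

text \<open>The evaluation of \<open>[a\<^sub>s b]\<^sub>t v\<close>.\<close>

lemma ev_bracket_act:
  fixes a b v :: free_elem and s t :: "complex poly poly" and l m :: complex
  defines "A \<equiv> Poly_Mapping.keys a" and "B \<equiv> Poly_Mapping.keys b" and "C \<equiv> Poly_Mapping.keys v"
  defines "s' \<equiv> ev_poly s l m" and "t' \<equiv> ev_poly t l m"
  shows "ev_free2 \<epsilon> d l m
      (lambda_compose free_scale s t (\<lambda>x. sesqui_extend P x v) (sesqui_extend Q a b)) =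
    (\<Sum>\<alpha>\<in>A. \<Sum>\<beta>\<in>B. \<Sum>\<gamma>\<in>C. if \<alpha> + \<beta> + \<gamma> = \<epsilon> then
        poly (Poly_Mapping.lookup a \<alpha>) (- s') * poly (Poly_Mapping.lookup b \<beta>) (s' - t')
        * poly (Poly_Mapping.lookup v \<gamma>) (d + t')
        * ev_poly (Q \<alpha> \<beta>) (- t') s' * ev_poly (P (\<alpha> + \<beta>) \<gamma>) d t' else 0)"
proof -
  define T where "T = (\<lambda>(\<beta>, \<gamma>). \<beta> + \<gamma>) ` (A \<times> B)"
  have T: "finite T" by (simp add: T_def A_def B_def)
  have inT: "\<beta> \<in> A \<Longrightarrow> \<gamma> \<in> B \<Longrightarrow> \<beta> + \<gamma> \<in> T" for \<beta> \<gamma> by (auto simp: T_def)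
  let ?q = "sesqui_extend Q a b"
  let ?v = "\<lambda>\<gamma>. poly (Poly_Mapping.lookup v \<gamma>) (d + t')"
  have kq: "Poly_Mapping.keys (coeff ?q k) \<subseteq> T" for k
    unfolding T_def A_def B_def by (rule keys_coeff_sesqui_extend)
  have "ev_free2 \<epsilon> d l m (lambda_compose free_scale s t (\<lambda>x. sesqui_extend P x v) ?q) =
     (\<Sum>k\<le>degree ?q. s' ^ k * ev_free \<epsilon> d t' (sesqui_extend P (coeff ?q k) v))"
    by (simp add: ev_lambda_compose s'_def t'_def)
  also have "\<dots> = (\<Sum>k\<le>degree ?q. s' ^ k * (\<Sum>\<delta>\<in>T. \<Sum>\<gamma>\<in>C. if \<delta> + \<gamma> = \<epsilon> then
       poly (Poly_Mapping.lookup (coeff ?q k) \<delta>) (- t') * ?v \<gamma> * ev_poly (P \<delta> \<gamma>) d t' else 0))"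
    by (subst ev_sesqui_extend[OF T _ kq, of C]) (simp_all add: C_def)
  also have "\<dots> = (\<Sum>k\<le>degree ?q. \<Sum>\<delta>\<in>T. \<Sum>\<gamma>\<in>C. if \<delta> + \<gamma> = \<epsilon> then
       (s' ^ k * poly (Poly_Mapping.lookup (coeff ?q k) \<delta>) (- t')) * (?v \<gamma> * ev_poly (P \<delta> \<gamma>) d t') else 0)"
    by (simp add: sum_distrib_left if_distrib mult_ac cong: if_cong)
  also have "\<dots> = (\<Sum>\<delta>\<in>T. \<Sum>\<gamma>\<in>C. \<Sum>k\<le>degree ?q. if \<delta> + \<gamma> = \<epsilon> then
       (s' ^ k * poly (Poly_Mapping.lookup (coeff ?q k) \<delta>) (- t')) * (?v \<gamma> * ev_poly (P \<delta> \<gamma>) d t') else 0)"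
    by (subst sum.swap, rule sum.cong[OF refl], subst sum.swap) simp
  also have "\<dots> = (\<Sum>\<delta>\<in>T. \<Sum>\<gamma>\<in>C. if \<delta> + \<gamma> = \<epsilon> then
       ev_free \<delta> (- t') s' ?q * (?v \<gamma> * ev_poly (P \<delta> \<gamma>) d t') else 0)"
    by (intro sum.cong refl) (simp add: ev_sum_coeff[symmetric] sum_distrib_right)
  also have "\<dots> = (\<Sum>\<delta>\<in>T. \<Sum>\<gamma>\<in>C. \<Sum>\<alpha>\<in>A. \<Sum>\<beta>\<in>B. if \<delta> = \<alpha> + \<beta> then
      (if \<alpha> + \<beta> + \<gamma> = \<epsilon> then
        poly (Poly_Mapping.lookup a \<alpha>) (- s') * poly (Poly_Mapping.lookup b \<beta>) (s' - t') * ?v \<gamma>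
        * ev_poly (Q \<alpha> \<beta>) (- t') s' * ev_poly (P (\<alpha> + \<beta>) \<gamma>) d t' else 0) else 0)"
    (is "_ = (\<Sum>\<delta>\<in>T. \<Sum>\<gamma>\<in>C. \<Sum>\<alpha>\<in>A. \<Sum>\<beta>\<in>B. if _ then ?r \<alpha> \<beta> \<gamma> else 0)")
    by (intro sum.cong refl, subst ev_sesqui_extend[of A B])
      (auto simp: A_def B_def sum_distrib_left sum_distrib_right mult_ac intro!: sum.cong sum.neutral)
  also have "\<dots> = (\<Sum>\<gamma>\<in>C. \<Sum>\<alpha>\<in>A. \<Sum>\<beta>\<in>B. \<Sum>\<delta>\<in>T. if \<delta> = \<alpha> + \<beta> then ?r \<alpha> \<beta> \<gamma> else 0)"
    by (subst sum.swap, rule sum.cong[OF refl], subst sum.swap, rule sum.cong[OF refl], rule sum.swap)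
  also have "\<dots> = (\<Sum>\<gamma>\<in>C. \<Sum>\<alpha>\<in>A. \<Sum>\<beta>\<in>B. ?r \<alpha> \<beta> \<gamma>)"
    using T inT by (intro sum.cong refl) (simp add: sum.delta)
  also have "\<dots> = (\<Sum>\<alpha>\<in>A. \<Sum>\<beta>\<in>B. \<Sum>\<gamma>\<in>C. ?r \<alpha> \<beta> \<gamma>)"
    by (subst sum.swap, rule sum.cong[OF refl], rule sum.swap)
  finally show ?thesis .
qed

lemma ev_sesqui_extend_keys:
  "ev_free \<epsilon> d l (sesqui_extend P f g) =
    (\<Sum>\<beta>\<in>Poly_Mapping.keys f. \<Sum>\<gamma>\<in>Poly_Mapping.keys g. if \<beta> + \<gamma> = \<epsilon>
       then poly (Poly_Mapping.lookup f \<beta>) (- l) * poly (Poly_Mapping.lookup g \<gamma>) (d + l) * ev_poly (P \<beta> \<gamma>) d l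
       else 0)"
  by (rule ev_sesqui_extend) auto

lemma sesqui_extend_add_left: "sesqui_extend P (f + f') g = sesqui_extend P f g + sesqui_extend P f' g"
proof (rule ev_free_eqI)
  fix \<epsilon> d l
  define S where "S = Poly_Mapping.keys f \<union> Poly_Mapping.keys f'"
  have S: "finite S" "Poly_Mapping.keys f \<subseteq> S" "Poly_Mapping.keys f' \<subseteq> S" "Poly_Mapping.keys (f + f') \<subseteq> S"
    using keys_add[of f f'] by (auto simp: S_def)
  note ev = ev_sesqui_extend[OF S(1) finite_keys _ order_refl]
  show "ev_free \<epsilon> d l (sesqui_extend P (f + f') g) =
      ev_free \<epsilon> d l (sesqui_extend P f g + sesqui_extend P f' g)"
    by (auto simp: ev S lookup_add sum.distrib[symmetric] algebra_simps intro!: sum.cong)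
qed

lemma sesqui_extend_add_right: "sesqui_extend P f (g + g') = sesqui_extend P f g + sesqui_extend P f g'"
proof (rule ev_free_eqI)
  fix \<epsilon> d l
  define S where "S = Poly_Mapping.keys g \<union> Poly_Mapping.keys g'"
  have S: "finite S" "Poly_Mapping.keys g \<subseteq> S" "Poly_Mapping.keys g' \<subseteq> S" "Poly_Mapping.keys (g + g') \<subseteq> S"
    using keys_add[of g g'] by (auto simp: S_def)
  note ev = ev_sesqui_extend[OF finite_keys S(1) order_refl]
  show "ev_free \<epsilon> d l (sesqui_extend P f (g + g')) =
      ev_free \<epsilon> d l (sesqui_extend P f g + sesqui_extend P f g')"
    by (auto simp: ev S lookup_add sum.distrib[symmetric] algebra_simps intro!: sum.cong)
qed

lemma keys_free_scale: "Poly_Mapping.keys (free_scale p f) \<subseteq> Poly_Mapping.keys f"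
  by (auto simp: in_keys_iff)

lemma ev_sesqui_extend_scale:
  "ev_free \<epsilon> d l (sesqui_extend P (free_scale p f) g) = poly p (- l) * ev_free \<epsilon> d l (sesqui_extend P f g)"
  "ev_free \<epsilon> d l (sesqui_extend P f (free_scale p g)) = poly p (d + l) * ev_free \<epsilon> d l (sesqui_extend P f g)"
proof -
  note ev = ev_sesqui_extend[where S = "Poly_Mapping.keys f" and T = "Poly_Mapping.keys g", OF finite_keys finite_keys]
  show "ev_free \<epsilon> d l (sesqui_extend P (free_scale p f) g) = poly p (- l) * ev_free \<epsilon> d l (sesqui_extend P f g)"
    by (simp add: ev[OF keys_free_scale order_refl] ev[OF order_refl order_refl]
        sum_distrib_left if_distrib mult_ac cong: if_cong)
  show "ev_free \<epsilon> d l (sesqui_extend P f (free_scale p g)) = poly p (d + l) * ev_free \<epsilon> d l (sesqui_extend P f g)"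
    by (simp add: ev[OF order_refl keys_free_scale] ev[OF order_refl order_refl]
        sum_distrib_left if_distrib mult_ac cong: if_cong)
qed

lemma subspace_free_carrier: "module.subspace free_scale (free_carrier \<Delta>)"
proof -
  interpret module free_scale by (rule module_free_scale)
  show ?thesis
    unfolding subspace_def free_carrier_def mem_Collect_eq
    by (simp, meson Un_least keys_add keys_free_scale order_trans)
qed

lemma CL_jacobi_identity:
  fixes b :: complex
  assumes "b \<noteq> 0" "\<phi> (\<beta> + \<gamma>) = \<phi> \<beta> + \<phi> \<gamma>" "\<phi> (\<alpha> + \<beta>) = \<phi> \<alpha> + \<phi> \<beta>" "\<phi> (\<alpha> + \<gamma>) = \<phi> \<alpha> + \<phi> \<gamma>"
  shows "ev_poly (CL_coeff b \<phi> \<beta> \<gamma>) (d + l) m * ev_poly (CL_coeff b \<phi> \<alpha> (\<beta> + \<gamma>)) d l =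
    ev_poly (CL_coeff b \<phi> \<alpha> \<beta>) (- (l + m)) l * ev_poly (CL_coeff b \<phi> (\<alpha> + \<beta>) \<gamma>) d (l + m)
    + ev_poly (CL_coeff b \<phi> \<alpha> \<gamma>) (d + m) l * ev_poly (CL_coeff b \<phi> \<beta> (\<alpha> + \<gamma>)) d m"
proof -
  define p q r where "p = \<phi> \<alpha> / b" and "q = \<phi> \<beta> / b" and "r = \<phi> \<gamma> / b"
  have \<phi>: "\<phi> \<alpha> = b * p" "\<phi> \<beta> = b * q" "\<phi> \<gamma> = b * r"
    using assms(1) by (simp_all add: p_def q_def r_def)
  have *: "1 / b * (b * x * \<epsilon> - b * y * \<delta> + b * (b * x - b * y)) = x * \<epsilon> - y * \<delta> + b * (x - y)"
    for x y \<delta> \<epsilon>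
    using assms(1) by (simp add: field_simps)
  show ?thesis
    unfolding CL_coeff_def ev_poly_simps assms(2-4) \<phi> distrib_left[symmetric] *
    by (simp add: algebra_simps)
qed

lemma lie_conformal_algebra_CL:
  assumes "additive_subgroup_of_complex \<Delta>" "2 * b \<notin> \<Delta>" "additive_hom_on \<Delta> \<phi>"
  shows "lie_conformal_algebra free_scale (free_carrier \<Delta>) (CL_bracket b \<phi>)"
proof -
  interpret module free_scale by (rule module_free_scale)
  have b: "b \<noteq> 0"
    using assms(1,2) by (auto simp: additive_subgroup_of_complex_def)
  have hom: "\<phi> (\<alpha> + \<beta>) = \<phi> \<alpha> + \<phi> \<beta>" if "\<alpha> \<in> \<Delta>" "\<beta> \<in> \<Delta>" for \<alpha> \<beta>
    using assms(3) that by (simp add: additive_hom_on_def)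
  have closed: "\<alpha> + \<beta> \<in> \<Delta>" if "\<alpha> \<in> \<Delta>" "\<beta> \<in> \<Delta>" for \<alpha> \<beta>
    using assms(1) that by (simp add: additive_subgroup_of_complex_def)
  have skew: "ev_poly (CL_coeff b \<phi> \<beta> \<alpha>) d (- l - d) = - ev_poly (CL_coeff b \<phi> \<alpha> \<beta>) d l" for \<alpha> \<beta> d l
    using b by (simp add: CL_coeff_def field_simps)
  show ?thesis
  proof
    fix x y z :: free_elem and n c
    assume x: "x \<in> free_carrier \<Delta>" and y: "y \<in> free_carrier \<Delta>"
    show "coeff (CL_bracket b \<phi> x y) n \<in> free_carrier \<Delta>"
      using keys_coeff_sesqui_extend[of "CL_coeff b \<phi>" x y n] x y closed
      by (fastforce simp: free_carrier_def CL_bracket_def)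
    show "CL_bracket b \<phi> (free_scale [:c:] x) y = map_poly (free_scale [:c:]) (CL_bracket b \<phi> x y)"
      by (rule ev_free_eqI) (simp add: CL_bracket_def ev_sesqui_extend_scale ev_free_scale)
    show "CL_bracket b \<phi> x (free_scale [:c:] y) = map_poly (free_scale [:c:]) (CL_bracket b \<phi> x y)"
      by (rule ev_free_eqI) (simp add: CL_bracket_def ev_sesqui_extend_scale ev_free_scale)
    show "CL_bracket b \<phi> (free_scale [:0, 1:] x) y = - pCons 0 (CL_bracket b \<phi> x y)"
      by (rule ev_free_eqI) (simp add: CL_bracket_def ev_sesqui_extend_scale ev_free_scale)
    show "CL_bracket b \<phi> x (free_scale [:0, 1:] y) =
        pCons 0 (CL_bracket b \<phi> x y) + map_poly (free_scale [:0, 1:]) (CL_bracket b \<phi> x y)"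
      by (rule ev_free_eqI)
        (simp add: CL_bracket_def ev_sesqui_extend_scale ev_free_scale algebra_simps)
    show "CL_bracket b \<phi> x y =
        - lambda_subst free_scale (- outer_var - inner_var) (CL_bracket b \<phi> y x)"
    proof (rule ev_free_eqI)
      fix \<epsilon> d l
      have "ev_free \<epsilon> d l (- lambda_subst free_scale (- outer_var - inner_var) (CL_bracket b \<phi> y x)) =
          - ev_free \<epsilon> d (- l - d) (CL_bracket b \<phi> y x)"
        by (simp add: ev_lambda_subst)
      also have "\<dots> = ev_free \<epsilon> d l (CL_bracket b \<phi> x y)"
        unfolding CL_bracket_def ev_sesqui_extend_keys
        by (subst sum.swap, unfold sum_negf[symmetric], intro sum.cong refl)
          (simp add: skew add.commute)
      finally show "ev_free \<epsilon> d l (CL_bracket b \<phi> x y) =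
        ev_free \<epsilon> d l (- lambda_subst free_scale (- outer_var - inner_var) (CL_bracket b \<phi> y x))" ..
    qed
    assume z: "z \<in> free_carrier \<Delta>"
    show "lambda_compose free_scale outer_var inner_var (CL_bracket b \<phi> x) (CL_bracket b \<phi> y z) =
        lambda_compose free_scale inner_var (inner_var + outer_var) (\<lambda>w. CL_bracket b \<phi> w z) (CL_bracket b \<phi> x y)
        + lambda_compose free_scale inner_var outer_var (CL_bracket b \<phi> y) (CL_bracket b \<phi> x z)"
      unfolding CL_bracket_def
    proof (rule ev_free2_eqI)
      fix \<epsilon> d l m
      let ?P = "CL_coeff b \<phi>"
      let ?X = "\<lambda>\<alpha>. poly (Poly_Mapping.lookup x \<alpha>) (- l)"
      let ?Y = "\<lambda>\<beta>. poly (Poly_Mapping.lookup y \<beta>) (- m)"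
      let ?Z = "\<lambda>\<gamma>. poly (Poly_Mapping.lookup z \<gamma>) (d + l + m)"
      have "ev_free2 \<epsilon> d l m (lambda_compose free_scale outer_var inner_var
                (sesqui_extend ?P x) (sesqui_extend ?P y z)) =
          (\<Sum>\<alpha>\<in>Poly_Mapping.keys x. \<Sum>\<beta>\<in>Poly_Mapping.keys y. \<Sum>\<gamma>\<in>Poly_Mapping.keys z.
             if \<alpha> + \<beta> + \<gamma> = \<epsilon> then ?X \<alpha> * ?Y \<beta> * ?Z \<gamma> *
               (ev_poly (?P \<beta> \<gamma>) (d + l) m * ev_poly (?P \<alpha> (\<beta> + \<gamma>)) d l) else 0)"
        by (simp add: ev_act_act mult.assoc cong: if_cong)
      also have "\<dots> = (\<Sum>\<alpha>\<in>Poly_Mapping.keys x. \<Sum>\<beta>\<in>Poly_Mapping.keys y. \<Sum>\<gamma>\<in>Poly_Mapping.keys z.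
             if \<alpha> + \<beta> + \<gamma> = \<epsilon> then ?X \<alpha> * ?Y \<beta> * ?Z \<gamma> *
               (ev_poly (?P \<alpha> \<beta>) (- (l + m)) l * ev_poly (?P (\<alpha> + \<beta>) \<gamma>) d (l + m)
                + ev_poly (?P \<alpha> \<gamma>) (d + m) l * ev_poly (?P \<beta> (\<alpha> + \<gamma>)) d m) else 0)"
        by (intro sum.cong refl, subst CL_jacobi_identity[OF b])
          (use x y z hom in \<open>auto simp: free_carrier_def subset_iff\<close>)
      also have "\<dots> = (\<Sum>\<alpha>\<in>Poly_Mapping.keys x. \<Sum>\<beta>\<in>Poly_Mapping.keys y. \<Sum>\<gamma>\<in>Poly_Mapping.keys z.
             if \<alpha> + \<beta> + \<gamma> = \<epsilon> then ?X \<alpha> * ?Y \<beta> * ?Z \<gamma> *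
               (ev_poly (?P \<alpha> \<beta>) (- (l + m)) l * ev_poly (?P (\<alpha> + \<beta>) \<gamma>) d (l + m)) else 0)
          + (\<Sum>\<beta>\<in>Poly_Mapping.keys y. \<Sum>\<alpha>\<in>Poly_Mapping.keys x. \<Sum>\<gamma>\<in>Poly_Mapping.keys z.
             if \<beta> + \<alpha> + \<gamma> = \<epsilon> then ?X \<alpha> * ?Y \<beta> * ?Z \<gamma> *
               (ev_poly (?P \<alpha> \<gamma>) (d + m) l * ev_poly (?P \<beta> (\<alpha> + \<gamma>)) d m) else 0)"
        by (subst sum.swap[of _ "Poly_Mapping.keys x" "Poly_Mapping.keys y"],
            unfold sum.distrib[symmetric], intro sum.cong refl)
          (simp add: distrib_left add.commute[of _ "_ :: complex"])
      also have "\<dots> = ev_free2 \<epsilon> d l m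
          (lambda_compose free_scale inner_var (inner_var + outer_var)
             (\<lambda>w. sesqui_extend ?P w z) (sesqui_extend ?P x y)
           + lambda_compose free_scale inner_var outer_var (sesqui_extend ?P y) (sesqui_extend ?P x z))"
        unfolding ev_free2_add ev_act_act ev_bracket_act
        by (intro arg_cong2[where f = "(+)"] sum.cong refl) (simp_all add: add_ac mult_ac)
      finally show "ev_free2 \<epsilon> d l m (lambda_compose free_scale outer_var inner_var
                (sesqui_extend ?P x) (sesqui_extend ?P y z)) =
          ev_free2 \<epsilon> d l m
            (lambda_compose free_scale inner_var (inner_var + outer_var)
               (\<lambda>w. sesqui_extend ?P w z) (sesqui_extend ?P x y)
             + lambda_compose free_scale inner_var outer_var (sesqui_extend ?P y) (sesqui_extend ?P x z))" .
    qed
  qed (auto simp: CL_bracket_def sesqui_extend_add_left sesqui_extend_add_right subspace_free_carrier)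
qed

end

theory Submission
  imports Defs
begin

text \<open>
  The generator \<open>x\<^sub>\<beta>\<close> sends \<open>M\<^sub>\<gamma>\<close> to \<open>F \<beta> \<gamma>(\<partial>, \<lambda>) M\<^bsub>\<beta>+\<gamma>\<^esub>\<close>, so the module is encoded by its structure
  polynomials \<open>F \<beta> \<gamma>\<close>, and the module axiom is a quadratic functional equation between them. Replacing
  \<open>\<partial>\<close> by \<open>\<partial> + \<phi>(\<beta>+\<gamma>)/b\<close> and \<open>\<lambda>\<close> by \<open>\<lambda> - \<phi>(\<beta>)/b\<close> removes \<open>\<phi>\<close> from this equation; call the resulting
  polynomials \<open>P \<beta> \<gamma>\<close>.

  The element \<open>x\<^sub>0\<close> generates a Virasoro conformal algebra, and on a free module of rank one it acts by zero
  or by \<open>b(\<partial> + c + q \<lambda>)\<close> (\<open>virasoro_rank_one\<close>). In a non-trivial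
  module \<open>x\<^sub>0\<close> does not act by zero (\<open>virasoro_nontrivial\<close>). If \<open>x\<^sub>0\<close> acts on some \<open>M\<^sub>\<gamma>\<close> by a nonzero polynomial, then a
  factorisation argument shows that no \<open>P \<beta> \<gamma>\<close> vanishes (\<open>nonzero_from_virasoro\<close>), and \<open>x\<^sub>0\<close> acts on every
  \<open>M\<^sub>\<gamma>\<close> with one common constant \<open>c\<close>, which a further translation of \<open>\<partial>\<close> makes zero, and with a weight
  \<open>q \<gamma>\<close> (\<open>virasoro_weights\<close>). The term linear in \<open>\<lambda>\<close> of the commutator of \<open>x\<^sub>0\<close> and
  \<open>x\<^sub>\<beta>\<close> is Euler's equation for \<open>P \<beta> \<gamma>\<close>. Hence \<open>P \<beta> \<gamma>\<close> is homogeneous of degree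
  \<open>1 + \<beta>/b + q \<gamma> - q (\<beta>+\<gamma>)\<close>, which is therefore a natural number (\<open>homogeneous\<close>).

  The degrees of \<open>P \<beta> \<gamma>\<close> and \<open>P (-\<beta>) (\<beta>+\<gamma>)\<close> add up to 2, so both are 0, 1 or 2. In degrees 0 and 1 the
  commutator with \<open>x\<^sub>0\<close> determines \<open>P \<beta> \<gamma>\<close> up to a scalar for all weights, and in degree 2 it also forces
  \<open>q (\<beta>+\<gamma>) = 0\<close> or \<open>q \<gamma> = 1\<close> (\<open>normal_form\<close>). Consequently \<open>q \<gamma> - \<gamma>/b\<close> takes at most two values, which then differ
  by 1, and if there are two, one of them is taken at a single index. These possibilities are the weights
  of \<open>V\<^sub>c\<^sub>,\<^sub>e\<close>, \<open>V\<^sub>A\<^sub>1\<^sub>,\<^sub>c\<close> and \<open>V\<^sub>A\<^sub>2\<^sub>,\<^sub>c\<close> (\<open>weights_classification\<close>).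

  What remains free is the leading coefficient of each \<open>P \<beta> \<gamma>\<close>. The functional equation makes these
  coefficients a cocycle, which is a coboundary because \<open>\<Delta>\<close> acts simply transitively on itself; multiplying the
  generators by scalars turns all of them into the coefficients of the model
  (\<open>lead_cocycle\<close>, \<open>lead_coboundary\<close>).
\<close>

section \<open>Polynomials in two variables\<close>

lemma ev_poly_eqI:
  assumes "\<And>d l. ev_poly P d l = ev_poly Q d l"
  shows "P = Q"
proof (rule poly_eqI, rule poly_eqI_infinite)
  fix n d
  have "map_poly (\<lambda>p. poly p d) P = map_poly (\<lambda>p. poly p d) Q"
    using assms by (intro poly_eqI_infinite) (simp add: ev_poly_alt)
  from arg_cong[OF this, of "\<lambda>p. coeff p n"]
  show "poly (coeff P n) d = poly (coeff Q n) d"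
    by (simp add: coeff_map_poly)
qed

lemma ev_poly_pCons: "ev_poly (pCons p P) d l = poly p d + l * ev_poly P d l"
  by (simp add: ev_poly_def)

text \<open>Polynomial substitutions exist as polynomials; this is what makes the translations of \<open>\<partial>\<close> and \<open>\<lambda>\<close>
  and the restrictions to lines below available without computing coefficients.\<close>

lemma ex_ev_poly_subst:
  "\<exists>Q. \<forall>d l. ev_poly Q d l = ev_poly P (ev_poly A d l) (ev_poly B d l)"
proof (induction P)
  case 0
  show ?case by (rule exI[of _ 0]) simp
next
  case (pCons p P)
  then obtain Q where "\<And>d l. ev_poly Q d l = ev_poly P (ev_poly A d l) (ev_poly B d l)"
    by blast
  then show ?case
    by (intro exI[of _ "poly_at p A + B * Q"]) (simp add: ev_poly_pCons)
qed

lemma ex_poly_on_line: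
  "\<exists>p. \<forall>s. poly p s = ev_poly P (s * d + d') (s * l + l')"
proof -
  obtain Q where Q: "\<And>s t. ev_poly Q s t = ev_poly P (s * d + d') (s * l + l')"
    using ex_ev_poly_subst[of P "inner_var * cst d + cst d'" "inner_var * cst l + cst l'"] by auto
  show ?thesis
    by (rule exI[of _ "poly Q 0"]) (use Q[of _ 0] in \<open>simp add: ev_poly_def\<close>)
qed

lemma has_field_derivative_ev_poly [derivative_intros]:
  assumes "(f has_field_derivative f') (at s within S)" "(g has_field_derivative g') (at s within S)"
  shows "((\<lambda>s. ev_poly P (f s) (g s)) has_field_derivative
    f' * ev_poly (map_poly pderiv P) (f s) (g s) + g' * ev_poly (pderiv P) (f s) (g s)) (at s within S)"
proof (induction P)
  case 0
  show ?case by simp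
next
  case (pCons p P)
  show ?case
    unfolding ev_poly_pCons
    by (rule derivative_eq_intros pCons assms DERIV_chain2[OF poly_DERIV] refl)+
      (simp add: map_poly_pCons pderiv_pCons ev_poly_pCons algebra_simps)
qed

text \<open>Compared coefficientwise, Euler's equation says that a monomial of total degree \<open>i + j\<close> can occur only
  if \<open>i + j = n\<close>. So the mere existence of a nonzero solution forces the complex number \<open>n\<close> to be natural.\<close>

lemma euler_homogeneous:
  assumes euler: "\<And>d l. d * ev_poly (map_poly pderiv P) d l + l * ev_poly (pderiv P) d l = n * ev_poly P d l"
    and "P \<noteq> 0"
  obtains k x where "n = of_nat k"
    and "\<And>d l. ev_poly P d l = (\<Sum>j\<le>k. x j * d ^ (k - j) * l ^ j)"
proof -
  have "inner_var * map_poly pderiv P + outer_var * pderiv P = cst n * P"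
    by (rule ev_poly_eqI) (simp add: euler)
  then have "coeff (coeff (inner_var * map_poly pderiv P + outer_var * pderiv P) j) i
      = coeff (coeff (cst n * P) j) i" for i j
    by simp
  moreover have "coeff (coeff (inner_var * map_poly pderiv P) j) i = of_nat i * coeff (coeff P j) i" for i j
    by (cases i) (simp_all add: inner_var_def coeff_map_poly coeff_pderiv)
  moreover have "coeff (coeff (outer_var * pderiv P) j) i = of_nat j * coeff (coeff P j) i" for i j
    by (cases j) (simp_all add: outer_var_def coeff_pderiv of_nat_poly del: of_nat_Suc)
  moreover have "coeff (coeff (cst n * P) j) i = n * coeff (coeff P j) i" for i j
    by (simp add: cst_def)
  ultimately have "of_nat i * coeff (coeff P j) i + of_nat j * coeff (coeff P j) i = n * coeff (coeff P j) i" for i j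
    by (metis coeff_add)
  then have coeffs: "(of_nat (i + j) - n) * coeff (coeff P j) i = 0" for i j
    by (simp add: algebra_simps)
  from \<open>P \<noteq> 0\<close> obtain j where "coeff P j \<noteq> 0" by (auto simp: poly_eq_iff)
  then obtain i where "coeff (coeff P j) i \<noteq> 0" by (auto simp: poly_eq_iff)
  with coeffs have n: "n = of_nat (i + j)" by (metis eq_iff_diff_eq_0 mult_eq_0_iff)
  define k where "k = i + j"
  have zero: "coeff (coeff P j) i = 0" if "i + j \<noteq> k" for i j
    using coeffs[of i j] that unfolding n k_def of_nat_diff by (simp flip: of_nat_add)
  define x where "x j = coeff (coeff P j) (k - j)" for j
  have "P = (\<Sum>j\<le>k. monom (monom (x j) (k - j)) j)"
  proof (intro poly_eqI)
    fix j i
    show "coeff (coeff P j) i = coeff (coeff (\<Sum>j\<le>k. monom (monom (x j) (k - j)) j) j) i"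
      using zero[of i j] by (auto simp: coeff_sum x_def if_distrib[of "\<lambda>p. coeff p i"] cong: if_cong)
  qed
  then have "ev_poly P d l = (\<Sum>j\<le>k. x j * d ^ (k - j) * l ^ j)" for d l
    by (subst \<open>P = _\<close>) (simp add: ev_poly_def poly_sum poly_monom poly_const_pow mult_ac)
  with n show thesis by (intro that[of k x]) (simp_all add: k_def)
qed

text \<open>At \<open>l = 0\<close> the equation gives \<open>P(d, 0) = b(d + c)\<close>. After the translation that makes \<open>c = 0\<close>, its
  \<open>l\<close>-derivative at \<open>l = 0\<close> reads \<open>b(d P\<^sub>d + m P\<^sub>m) = (b + u(d + m) - u(d)) P\<close>, where \<open>u(d) = P\<^sub>l(d, 0)\<close>. The
  Euler operator on the left does not raise degrees, so the factor on the right is the constant \<open>b\<close>;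
  hence \<open>P\<close> is homogeneous of degree 1.\<close>

lemma virasoro_rank_one:
  fixes b :: complex
  assumes "b \<noteq> 0" "P \<noteq> 0"
    and P: "\<And>d l m. b * (l - m) * ev_poly P d (l + m)
      = ev_poly P (d + l) m * ev_poly P d l - ev_poly P (d + m) l * ev_poly P d m"
  obtains c q where "\<And>d l. ev_poly P d l = b * (d + c + q * l)"
proof -
  have "ev_poly P d m * (ev_poly P (d + m) 0 - ev_poly P d 0 - b * m) = 0" for d m
    using P[of 0 m d] by (simp add: algebra_simps)
  moreover obtain A where A: "\<And>d m. ev_poly A d m = ev_poly P (d + m) 0"
    using ex_ev_poly_subst[of P "inner_var + outer_var" 0] by auto
  moreover obtain B where B: "\<And>d m. ev_poly B d m = ev_poly P d 0"
    using ex_ev_poly_subst[of P "inner_var" 0] by auto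
  ultimately have "P * (A - B - cst b * outer_var) = 0"
    by (intro ev_poly_eqI) simp
  with \<open>P \<noteq> 0\<close> have "ev_poly (A - B - cst b * outer_var) d m = 0" for d m
    by simp
  then have lin: "ev_poly P (d + m) 0 = ev_poly P d 0 + b * m" for d m
    by (simp add: A B algebra_simps)
  define c where "c = ev_poly P 0 0 / b"
  have P0: "ev_poly P d 0 = b * (d + c)" for d
    using lin[of 0 d] \<open>b \<noteq> 0\<close> by (simp add: c_def algebra_simps)
  obtain H where H: "\<And>d l. ev_poly H d l = ev_poly P (d - c) l"
    using ex_ev_poly_subst[of P "inner_var - cst c" "outer_var"] by auto
  have "H \<noteq> 0"
  proof
    assume "H = 0"
    then have "ev_poly P d l = ev_poly 0 d l" for d l using H[of "d + c" l] by simp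
    with \<open>P \<noteq> 0\<close> show False using ev_poly_eqI by blast
  qed
  have H0: "ev_poly H d 0 = b * d" for d by (simp add: H P0)
  have HP: "b * (l - m) * ev_poly H d (l + m)
      = ev_poly H (d + l) m * ev_poly H d l - ev_poly H (d + m) l * ev_poly H d m" for d l m
    using P[of l m "d - c"] by (simp add: H algebra_simps)
  let ?x = "ev_poly (map_poly pderiv H)" and ?y = "ev_poly (pderiv H)"
  \<comment> \<open>The term linear in \<open>l\<close>.\<close>
  have der: "b * (d * ?x d m + m * ?y d m) = (b + ?y (d + m) 0 - ?y d 0) * ev_poly H d m" for d m
  proof -
    have "((\<lambda>l. b * (l - m) * ev_poly H d (l + m)) has_field_derivative
       b * ev_poly H d m - b * m * ?y d m) (at 0)"
      by (rule derivative_eq_intros refl)+ (simp add: algebra_simps)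
    moreover have "((\<lambda>l. ev_poly H (d + l) m * ev_poly H d l - ev_poly H (d + m) l * ev_poly H d m)
       has_field_derivative (?x d m * (b * d) + ev_poly H d m * ?y d 0
         - ?y (d + m) 0 * ev_poly H d m)) (at 0)"
      by (rule derivative_eq_intros refl)+ (simp add: algebra_simps H0)
    ultimately have "b * ev_poly H d m - b * m * ?y d m
        = ?x d m * (b * d) + ev_poly H d m * ?y d 0 - ?y (d + m) 0 * ev_poly H d m"
      unfolding HP by (rule DERIV_unique)
    then show ?thesis by (simp add: algebra_simps)
  qed
  \<comment> \<open>Along the line \<open>s \<mapsto> (s d, s m)\<close> the previous equation is \<open>b s p' = w p\<close>, which bounds the degree of \<open>w\<close>.\<close>
  have const: "?y (d + m) 0 = ?y d 0" if nz: "ev_poly H d m \<noteq> 0" for d m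
  proof -
    obtain p where p: "\<And>s. poly p s = ev_poly H (s * d) (s * m)"
      using ex_poly_on_line[of H d 0 m 0] by auto
    obtain u where u: "\<And>s. poly u s = ?y (s * (d + m)) 0"
      using ex_poly_on_line[of "pderiv H" "d + m" 0 0 0] by auto
    obtain v where v: "\<And>s. poly v s = ?y (s * d) 0"
      using ex_poly_on_line[of "pderiv H" d 0 0 0] by auto
    define w where "w = [:b:] + u - v"
    have "(poly p has_field_derivative d * ?x (s * d) (s * m) + m * ?y (s * d) (s * m)) (at s)" for s
      unfolding p[abs_def] by (rule derivative_eq_intros refl)+ simp
    then have p': "poly (pderiv p) s = d * ?x (s * d) (s * m) + m * ?y (s * d) (s * m)" for s
      using DERIV_unique poly_DERIV by blast
    have eq: "smult b (pCons 0 (pderiv p)) = w * p"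
      by (rule poly_eqI_infinite)
        (use der[of "_ * d" "_ * m"] in \<open>simp add: p p' u v w_def algebra_simps\<close>)
    have "p \<noteq> 0" using nz p[of 1] by auto
    have w0: "poly w 0 = b" by (simp add: w_def u v)
    with \<open>b \<noteq> 0\<close> have "w \<noteq> 0" by auto
    have "degree (smult b (pCons 0 (pderiv p))) \<le> degree p"
    proof (cases "degree p = 0")
      case True
      then show ?thesis by (auto elim!: degree_eq_zeroE)
    next
      case False
      then show ?thesis by (intro order.trans[OF degree_smult_le])
        (auto simp: degree_pCons_eq_if degree_pderiv)
    qed
    then have "degree w = 0"
      unfolding eq using \<open>w \<noteq> 0\<close> \<open>p \<noteq> 0\<close> by (simp add: degree_mult_eq)
    then have "poly w 1 = poly w 0" by (elim degree_eq_zeroE) simp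
    then have "poly w 1 = b" using w0 by simp
    then show ?thesis by (simp add: w_def u v)
  qed
  have "d * ?x d m + m * ?y d m = 1 * ev_poly H d m" for d m
    using der[of d m] const[of d m] \<open>b \<noteq> 0\<close> by (cases "ev_poly H d m = 0") auto
  from euler_homogeneous[OF this \<open>H \<noteq> 0\<close>] obtain k x where
    "1 = (of_nat k :: complex)" and Hx: "\<And>d l. ev_poly H d l = (\<Sum>j\<le>k. x j * d ^ (k - j) * l ^ j)"
    by blast
  then have "k = 1" by (metis of_nat_1 of_nat_eq_iff)
  then have Hx: "ev_poly H d l = x 0 * d + x 1 * l" for d l by (simp add: Hx)
  have "x 0 = b" using H0[of 1] by (simp add: Hx)
  then have "ev_poly P d l = b * (d + c + x 1 / b * l)" for d l
    using H[of "d + c" l] \<open>b \<noteq> 0\<close> by (simp add: Hx algebra_simps)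
  then show thesis by (rule that)
qed

section \<open>Structure polynomials of a graded module\<close>

text \<open>The next lemmas move \<open>lambda_compose\<close> along a module homomorphism. They allow the module axiom to be
  transported from \<open>V\<close> to the free module, where it can be evaluated at complex numbers.\<close>

lemma coeff_lambda_compose:
  assumes "module scale"
  shows "coeff (coeff (lambda_compose scale s t A q) i) j =
    (\<Sum>k\<le>degree q. \<Sum>n\<le>degree (A (coeff q k)).
       scale [:coeff (coeff (s ^ k * t ^ n) i) j:] (coeff (A (coeff q k)) n))"
proof -
  interpret module scale by fact
  show ?thesis by (simp add: lambda_compose_def coeff_sum coeff_map_poly)
qed

lemma map_lambda_compose:
  assumes "module_hom scale1 scale2 h"
  shows "map_poly (map_poly h) (lambda_compose scale1 s t A q) =
    lambda_compose scale2 s t (\<lambda>x. map_poly h (A x)) q"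
proof (intro poly_eqI)
  fix i j
  interpret module_hom scale1 scale2 h by fact
  have "coeff (coeff (map_poly (map_poly h) (lambda_compose scale1 s t A q)) i) j =
      (\<Sum>k\<le>degree q. \<Sum>n\<le>degree (A (coeff q k)).
         scale2 [:coeff (coeff (s ^ k * t ^ n) i) j:] (coeff (map_poly h (A (coeff q k))) n))"
    by (simp add: coeff_map_poly coeff_lambda_compose[OF m1.module_axioms] sum scale)
  also have "\<dots> = coeff (coeff (lambda_compose scale2 s t (\<lambda>x. map_poly h (A x)) q) i) j"
    unfolding coeff_lambda_compose[OF m2.module_axioms]
    by (intro sum.cong refl sum.mono_neutral_right)
      (auto simp: coeff_eq_0 intro: order.trans[OF map_poly_degree_leq])
  finally show "coeff (coeff (map_poly (map_poly h) (lambda_compose scale1 s t A q)) i) j =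
      coeff (coeff (lambda_compose scale2 s t (\<lambda>x. map_poly h (A x)) q) i) j" .
qed

lemma lambda_compose_map:
  assumes "module scale" "h 0 = 0" "A 0 = 0"
  shows "lambda_compose scale s t A (map_poly h q) = lambda_compose scale s t (\<lambda>x. A (h x)) q"
proof (intro poly_eqI)
  fix i j
  interpret module scale by fact
  have "h (coeff q k) = 0" if "degree (map_poly h q) < k" for k
    using coeff_eq_0[OF that] assms(2) by (simp add: coeff_map_poly)
  then show "coeff (coeff (lambda_compose scale s t A (map_poly h q)) i) j =
      coeff (coeff (lambda_compose scale s t (\<lambda>x. A (h x)) q) i) j"
    unfolding coeff_lambda_compose[OF assms(1)]
    by (intro sum.mono_neutral_cong_left)
      (use assms(2,3) in \<open>auto simp: coeff_map_poly not_le intro: order.trans[OF _ map_poly_degree_leq]\<close>)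
qed

lemma lambda_compose_cong:
  assumes "\<And>k. A (coeff q k) = B (coeff q k)"
  shows "lambda_compose scale s t A q = lambda_compose scale s t B q"
  by (simp add: lambda_compose_def assms)

text \<open>Sesquilinear maps are determined by their values on generators: it suffices to check closure under
  sums, complex multiples and \<open>\<partial>\<close>.\<close>

lemma free_carrier_induct [consumes 1, case_names add cscale D gen zero]:
  assumes "g \<in> free_carrier \<Delta>"
    and add: "\<And>f g. f \<in> free_carrier \<Delta> \<Longrightarrow> g \<in> free_carrier \<Delta> \<Longrightarrow> P f \<Longrightarrow> P g \<Longrightarrow> P (f + g)"
    and cscale: "\<And>c g. g \<in> free_carrier \<Delta> \<Longrightarrow> P g \<Longrightarrow> P (free_scale [:c:] g)"
    and D: "\<And>g. g \<in> free_carrier \<Delta> \<Longrightarrow> P g \<Longrightarrow> P (free_scale [:0, 1:] g)"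
    and gen: "\<And>\<alpha>. \<alpha> \<in> \<Delta> \<Longrightarrow> P (gen \<alpha>)"
    and zero: "P 0"
  shows "P g"
proof -
  interpret module free_scale by (rule module_free_scale)
  note closed = subspace_add[OF subspace_free_carrier] subspace_scale[OF subspace_free_carrier]
    subspace_sum[OF subspace_free_carrier]
  have g1: "gen \<alpha> \<in> free_carrier \<Delta>" if "\<alpha> \<in> \<Delta>" for \<alpha>
    using that by (simp add: free_carrier_def gen_def)
  have multiple: "P (free_scale p (gen \<alpha>))" if \<alpha>: "\<alpha> \<in> \<Delta>" for p \<alpha>
  proof (induction p)
    case 0
    then show ?case by (simp add: zero)
  next
    case (pCons c p)
    have "pCons c p = [:c:] + [:0, 1:] * p" by simp
    then have "free_scale (pCons c p) (gen \<alpha>) =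
        free_scale [:c:] (gen \<alpha>) + free_scale [:0, 1:] (free_scale p (gen \<alpha>))"
      by (simp only: scale_left_distrib scale_scale)
    then show ?case
      by (simp only:) (intro add cscale D gen pCons.IH \<alpha> closed g1)
  qed
  have "P (\<Sum>\<alpha>\<in>S. free_scale (Poly_Mapping.lookup g \<alpha>) (gen \<alpha>))" if "finite S" "S \<subseteq> \<Delta>" for S
    using that
  proof (induction S)
    case empty
    show ?case by (simp add: zero)
  next
    case (insert \<alpha> S)
    then show ?case by (auto intro!: add multiple closed g1 simp: subset_iff)
  qed
  moreover have "g = (\<Sum>\<alpha>\<in>Poly_Mapping.keys g. free_scale (Poly_Mapping.lookup g \<alpha>) (gen \<alpha>))"
    by (rule poly_mapping_eqI)
      (auto simp: lookup_sum gen_def lookup_single when_def in_keys_iff if_distrib cong: if_cong)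
  ultimately show ?thesis
    using \<open>g \<in> _\<close> by (metis finite_keys free_carrier_def mem_Collect_eq)
qed

lemma sesqui_extend_gen_gen:
  "sesqui_extend P (gen \<alpha>) (gen \<gamma>) = map_poly (Poly_Mapping.single (\<alpha> + \<gamma>)) (P \<alpha> \<gamma>)"
  by (rule ev_free_eqI) (simp add: ev_sesqui_extend_keys ev_free_single gen_def)

lemma sesqui_extend_D:
  "sesqui_extend P (free_scale [:0, 1:] f) g = - pCons 0 (sesqui_extend P f g)"
  "sesqui_extend P f (free_scale [:0, 1:] g) =
    map_poly (free_scale [:0, 1:]) (sesqui_extend P f g) + pCons 0 (sesqui_extend P f g)"
  by (rule ev_free_eqI; simp add: ev_sesqui_extend_scale ev_free_scale algebra_simps)+

lemma sesqui_extend_cscale: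
  "sesqui_extend P (free_scale [:c:] f) g = map_poly (free_scale [:c:]) (sesqui_extend P f g)"
  "sesqui_extend P f (free_scale [:c:] g) = map_poly (free_scale [:c:]) (sesqui_extend P f g)"
  by (rule ev_free_eqI; simp add: ev_sesqui_extend_scale ev_free_scale)+

text \<open>A choice of one generator \<open>m \<gamma>\<close> for each homogeneous component of a graded module, with the structure
  polynomials \<open>F\<close> of the action in these generators.\<close>

locale graded_basis =
  conformal_module free_scale "free_carrier \<Delta>" "CL_bracket b \<phi>" scale V act
  for \<Delta> :: "complex set" and b \<phi>
    and scale :: "complex poly \<Rightarrow> 'v::ab_group_add \<Rightarrow> 'v" and V act +
  fixes W :: "complex \<Rightarrow> 'v set" and m :: "complex \<Rightarrow> 'v"
    and F :: "complex \<Rightarrow> complex \<Rightarrow> complex poly poly"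
  assumes subgroup: "additive_subgroup_of_complex \<Delta>"
    and direct_sum: "internal_direct_sum \<Delta> V W"
    and W_eq: "\<alpha> \<in> \<Delta> \<Longrightarrow> W \<alpha> = range (\<lambda>p. scale p (m \<alpha>))"
    and free: "\<alpha> \<in> \<Delta> \<Longrightarrow> scale p (m \<alpha>) = 0 \<Longrightarrow> p = 0"
    and act_gen: "\<alpha> \<in> \<Delta> \<Longrightarrow> \<gamma> \<in> \<Delta> \<Longrightarrow>
      act (gen \<alpha>) (m \<gamma>) = map_poly (\<lambda>p. scale p (m (\<alpha> + \<gamma>))) (F \<alpha> \<gamma>)"
begin

lemma add_closed: "\<alpha> \<in> \<Delta> \<Longrightarrow> \<beta> \<in> \<Delta> \<Longrightarrow> \<alpha> + \<beta> \<in> \<Delta>"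
  using subgroup by (simp add: additive_subgroup_of_complex_def)

lemma gen_in: "\<alpha> \<in> \<Delta> \<Longrightarrow> gen \<alpha> \<in> free_carrier \<Delta>"
  by (simp add: free_carrier_def gen_def)

definition comb :: "free_elem \<Rightarrow> 'v" where
  "comb g = (\<Sum>\<gamma>\<in>Poly_Mapping.keys g. scale (Poly_Mapping.lookup g \<gamma>) (m \<gamma>))"

lemma comb_altdef:
  assumes "finite S" "Poly_Mapping.keys g \<subseteq> S"
  shows "comb g = (\<Sum>\<gamma>\<in>S. scale (Poly_Mapping.lookup g \<gamma>) (m \<gamma>))"
  unfolding comb_def using assms by (intro sum.mono_neutral_left) (auto simp: in_keys_iff)

lemma comb_single: "comb (Poly_Mapping.single \<gamma> p) = scale p (m \<gamma>)"
  by (subst comb_altdef[of "{\<gamma>}"]) (auto simp: lookup_single)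

lemma comb_gen: "comb (gen \<gamma>) = m \<gamma>"
  by (simp add: gen_def comb_single)

lemma module_hom_comb: "module_hom free_scale scale comb"
proof (intro module_hom.intro module_hom_axioms.intro module_free_scale module_axioms)
  fix f g :: free_elem and p
  define S where "S = Poly_Mapping.keys f \<union> Poly_Mapping.keys g"
  have S: "finite S" "Poly_Mapping.keys f \<subseteq> S" "Poly_Mapping.keys g \<subseteq> S" "Poly_Mapping.keys (f + g) \<subseteq> S"
    using keys_add[of f g] by (auto simp: S_def)
  show "comb (f + g) = comb f + comb g"
    by (simp add: comb_altdef[OF S(1)] S lookup_add scale_left_distrib sum.distrib)
  show "comb (free_scale p f) = scale p (comb f)"
    by (subst comb_altdef[OF finite_keys keys_free_scale]) (simp add: comb_def scale_sum_right)
qed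

sublocale comb: module_hom free_scale scale comb
  by (rule module_hom_comb)

lemma comb_bij: "bij_betw comb (free_carrier \<Delta>) V"
proof -
  let ?graded = "\<lambda>u. (\<forall>i\<in>\<Delta>. u i \<in> W i) \<and> (\<forall>i. i \<notin> \<Delta> \<longrightarrow> u i = 0) \<and> finite {i. u i \<noteq> 0}"
  have W: "W \<alpha> \<subseteq> V" if "\<alpha> \<in> \<Delta>" for \<alpha>
    using direct_sum that by (auto simp: internal_direct_sum_def)
  have ds: "\<exists>!u. ?graded u \<and> v = (\<Sum>i | u i \<noteq> 0. u i)" if "v \<in> V" for v
    using direct_sum that by (simp add: internal_direct_sum_def conj_assoc)
  have in_W: "scale p (m \<alpha>) \<in> W \<alpha>" if "\<alpha> \<in> \<Delta>" for p \<alpha>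
    using W_eq[OF that] by auto
  have comb_V: "comb g \<in> V" if "g \<in> free_carrier \<Delta>" for g
    unfolding comb_def
    by (intro subspace_sum[OF subspace_V] subsetD[OF W in_W]) (use that in \<open>auto simp: free_carrier_def\<close>)
  define parts where "parts g i = scale (Poly_Mapping.lookup g i) (m i)" for g i
  have parts: "?graded (parts g) \<and> comb g = (\<Sum>i | parts g i \<noteq> 0. parts g i)"
    if g: "g \<in> free_carrier \<Delta>" for g
  proof -
    have sub: "{i. parts g i \<noteq> 0} \<subseteq> Poly_Mapping.keys g"
      by (auto simp: parts_def in_keys_iff)
    then have "comb g = (\<Sum>i | parts g i \<noteq> 0. parts g i)"
      unfolding comb_def by (intro sum.mono_neutral_cong_right) (auto simp: parts_def)
    with sub show ?thesis
      using g finite_subset[OF sub finite_keys] in_W by (auto simp: parts_def free_carrier_def in_keys_iff subset_iff)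
  qed
  show ?thesis
  proof (rule bij_betw_imageI)
    show "inj_on comb (free_carrier \<Delta>)"
    proof (rule inj_onI)
      fix f g assume f: "f \<in> free_carrier \<Delta>" and g: "g \<in> free_carrier \<Delta>" and eq: "comb f = comb g"
      have "parts f = parts g"
        by (rule ex1E[OF ds[OF comb_V[OF f]]]) (use parts[OF f] parts[OF g] eq in metis)
      then have "scale (Poly_Mapping.lookup f i - Poly_Mapping.lookup g i) (m i) = 0" for i
        by (metis (no_types) parts_def scale_left_diff_distrib eq_iff_diff_eq_0)
      then have "Poly_Mapping.lookup f i = Poly_Mapping.lookup g i" if "i \<in> \<Delta>" for i
        using free[OF that] by fastforce
      moreover have "Poly_Mapping.lookup f i = Poly_Mapping.lookup g i" if "i \<notin> \<Delta>" for i
        using f g that by (metis free_carrier_def in_keys_iff mem_Collect_eq subsetD)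
      ultimately show "f = g" by (intro poly_mapping_eqI) blast
    qed
    show "comb ` free_carrier \<Delta> = V"
    proof (intro equalityI image_subsetI comb_V)
      show "V \<subseteq> comb ` free_carrier \<Delta>"
      proof
        fix v assume "v \<in> V"
        from ds[OF this] obtain u where u: "?graded u" "v = (\<Sum>i | u i \<noteq> 0. u i)"
          by (elim ex1E conjE) blast
        then have "\<forall>i\<in>\<Delta>. \<exists>p. u i = scale p (m i)" using W_eq by blast
        then obtain p where p: "\<And>i. i \<in> \<Delta> \<Longrightarrow> u i = scale (p i) (m i)" by metis
        let ?g = "\<Sum>i | u i \<noteq> 0. Poly_Mapping.single i (p i)"
        have "comb ?g = v"
          unfolding u(2) comb.sum comb_single using u(1) by (intro sum.cong refl p[symmetric]) auto
        moreover have "?g \<in> free_carrier \<Delta>"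
          using u(1) by (intro alg.subspace_sum[OF subspace_free_carrier])
            (auto simp: free_carrier_def)
        ultimately show "v \<in> comb ` free_carrier \<Delta>" by blast
      qed
    qed
  qed
qed

lemma comb_in: "g \<in> free_carrier \<Delta> \<Longrightarrow> comb g \<in> V"
  using comb_bij by (auto simp: bij_betw_def)

lemma comb_eq_iff: "f \<in> free_carrier \<Delta> \<Longrightarrow> g \<in> free_carrier \<Delta> \<Longrightarrow> comb f = comb g \<longleftrightarrow> f = g"
  using comb_bij by (auto simp: bij_betw_def inj_on_eq_iff)

lemma coeff_sesqui_extend_in:
  assumes "a \<in> free_carrier \<Delta>" "g \<in> free_carrier \<Delta>"
  shows "coeff (sesqui_extend P a g) n \<in> free_carrier \<Delta>"
  using keys_coeff_sesqui_extend[of P a g n] assms add_closed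
  by (fastforce simp: free_carrier_def)

lemma map_comb_add: "map_poly comb (p + q) = map_poly comb p + map_poly comb q"
  by (rule map_poly_add) (simp_all add: comb.add)

lemma map_comb_pCons: "map_poly comb (pCons x q) = pCons (comb x) (map_poly comb q)"
  by (simp add: map_poly_pCons)

lemma map_comb_minus: "map_poly comb (- q) = - map_poly comb q"
  by (rule poly_eqI) (simp add: coeff_map_poly comb.neg)

lemma map_comb_scale: "map_poly comb (map_poly (free_scale p) q) = map_poly (scale p) (map_poly comb q)"
  by (rule poly_eqI) (simp add: coeff_map_poly comb.scale)

lemma act_comb:
  assumes "a \<in> free_carrier \<Delta>" "g \<in> free_carrier \<Delta>"
  shows "act a (comb g) = map_poly comb (sesqui_extend F a g)"
  using assms
proof (induction a rule: free_carrier_induct)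
  case (gen \<alpha>)
  from \<open>g \<in> _\<close> show ?case
  proof (induction g rule: free_carrier_induct)
    case (gen \<gamma>)
    show ?case
      by (rule poly_eqI)
        (simp add: comb_gen act_gen \<open>\<alpha> \<in> \<Delta>\<close> gen sesqui_extend_gen_gen coeff_map_poly comb_single)
  next
    case zero
    show ?case using act_add_right[of "gen \<alpha>" 0 0] gen_in[OF \<open>\<alpha> \<in> \<Delta>\<close>] subspace_0[OF subspace_V]
      by (simp add: sesqui_extend_def)
  qed (simp_all add: comb.add comb.scale act_add_right act_cscale_right act_D_right comb_in gen_in gen
      sesqui_extend_add_right sesqui_extend_D sesqui_extend_cscale map_comb_add map_comb_pCons map_comb_scale)
next
  case zero
  show ?case using act_add_left[of 0 0 "comb g"] comb_in[OF \<open>g \<in> _\<close>] alg.subspace_0[OF subspace_free_carrier]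
    by (simp add: sesqui_extend_def)
qed (simp_all add: act_add_left act_cscale_left act_D_left comb_in 
      sesqui_extend_add_left sesqui_extend_D sesqui_extend_cscale map_comb_add map_comb_pCons
      map_comb_scale map_comb_minus)

text \<open>The structure polynomials determine the module. Agreement with \<open>F\<close> on \<open>\<Delta>\<close> is
  enough because \<open>sesqui_extend\<close> meets no other indices on the carriers.\<close>

lemma isomorphic_sesqui_extend:
  assumes P: "\<And>\<alpha> \<gamma>. \<alpha> \<in> \<Delta> \<Longrightarrow> \<gamma> \<in> \<Delta> \<Longrightarrow> P \<alpha> \<gamma> = F \<alpha> \<gamma>"
  shows "conformal_modules_isomorphic (free_carrier \<Delta>) scale V act
    free_scale (free_carrier \<Delta>) (sesqui_extend P)"
  unfolding conformal_modules_isomorphic_def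
proof (intro exI conjI ballI allI)
  let ?f = "the_inv_into (free_carrier \<Delta>) comb"
  have f_comb: "?f (comb g) = g" if "g \<in> free_carrier \<Delta>" for g
    using comb_bij that by (simp add: bij_betw_def the_inv_into_f_f)
  have ex: "\<exists>g\<in>free_carrier \<Delta>. v = comb g" if "v \<in> V" for v
    using comb_bij that by (auto simp: bij_betw_def)
  note closed = alg.subspace_add[OF subspace_free_carrier] alg.subspace_scale[OF subspace_free_carrier]
  show "bij_betw ?f V (free_carrier \<Delta>)" by (rule bij_betw_the_inv_into[OF comb_bij])
  fix u v p a
  assume v: "v \<in> V"
  then obtain g where g: "g \<in> free_carrier \<Delta>" "v = comb g" using ex by blast
  show "?f (scale p v) = free_scale p (?f v)"
    unfolding g(2) comb.scale[symmetric] using g(1) closed by (simp add: f_comb)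
  {
    assume "u \<in> V"
    then obtain h where h: "h \<in> free_carrier \<Delta>" "u = comb h" using ex by blast
    show "?f (u + v) = ?f u + ?f v"
      unfolding g(2) h(2) comb.add[symmetric] using g(1) h(1) closed by (simp add: f_comb)
  }
  assume a: "a \<in> free_carrier \<Delta>"
  have "?f 0 = 0"
    using f_comb[of 0] alg.subspace_0[OF subspace_free_carrier] by simp
  then have "map_poly ?f (act a v) = sesqui_extend F a g"
    by (intro poly_eqI) (simp add: g a act_comb coeff_map_poly f_comb coeff_sesqui_extend_in)
  also have "\<dots> = sesqui_extend P a g"
    unfolding sesqui_extend_def using a g(1) P
    by (intro sum.cong refl) (auto simp: free_carrier_def subset_iff)
  finally show "sesqui_extend P a (?f v) = map_poly ?f (act a v)"
    by (simp add: g f_comb)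
qed

lemma nontrivial_structure:
  assumes "nontrivial_action (free_carrier \<Delta>) V act"
  obtains \<alpha> \<gamma> where "\<alpha> \<in> \<Delta>" "\<gamma> \<in> \<Delta>" "F \<alpha> \<gamma> \<noteq> 0"
proof -
  obtain a v where "a \<in> free_carrier \<Delta>" "v \<in> V" "act a v \<noteq> 0"
    using assms by (auto simp: nontrivial_action_def)
  then obtain g where g: "g \<in> free_carrier \<Delta>" "act a (comb g) \<noteq> 0"
    using comb_bij by (auto simp: bij_betw_def)
  have "sesqui_extend F a g = 0" if "\<And>\<alpha> \<gamma>. \<alpha> \<in> \<Delta> \<Longrightarrow> \<gamma> \<in> \<Delta> \<Longrightarrow> F \<alpha> \<gamma> = 0"
    unfolding sesqui_extend_def using \<open>a \<in> _\<close> g(1) that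
    by (intro sum.neutral ballI) (auto simp: free_carrier_def subset_iff)
  moreover have "sesqui_extend F a g \<noteq> 0" using g \<open>a \<in> _\<close> by (auto simp: act_comb)
  ultimately show thesis using that by blast
qed

lemma act_comb_comb:
  assumes "a \<in> free_carrier \<Delta>" "c \<in> free_carrier \<Delta>" "g \<in> free_carrier \<Delta>"
  shows "lambda_compose scale s t (act a) (act c (comb g)) = map_poly (map_poly comb)
    (lambda_compose free_scale s t (sesqui_extend F a) (sesqui_extend F c g))"
proof -
  have "act a 0 = 0" using act_add_right[of a 0 0] assms(1) subspace_0[OF subspace_V] by simp
  then have "lambda_compose scale s t (act a) (act c (comb g)) =
      lambda_compose scale s t (\<lambda>x. act a (comb x)) (sesqui_extend F c g)"
    unfolding act_comb[OF assms(2,3)] by (intro lambda_compose_map) (simp_all add: module_axioms)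
  also have "\<dots> = lambda_compose scale s t (\<lambda>x. map_poly comb (sesqui_extend F a x)) (sesqui_extend F c g)"
    using assms by (intro lambda_compose_cong act_comb coeff_sesqui_extend_in)
  finally show ?thesis by (simp add: map_lambda_compose[OF module_hom_comb])
qed

text \<open>The module axiom on generators, read off in the component of index \<open>\<alpha> + \<beta> + \<gamma>\<close>: \<open>d\<close>, \<open>l\<close>, \<open>\<mu>\<close> are the values of
  \<open>\<partial>\<close>, \<open>\<lambda>\<close>, \<open>\<mu>\<close>. The bracket coefficient is evaluated at \<open>\<partial> = -(\<lambda> + \<mu>)\<close> because
  \<open>(\<partial>a)\<^bsub>\<lambda>+\<mu>\<^esub> v = -(\<lambda> + \<mu>) a\<^bsub>\<lambda>+\<mu>\<^esub> v\<close>.\<close>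

lemma structure_identity:
  assumes "\<alpha> \<in> \<Delta>" "\<beta> \<in> \<Delta>" "\<gamma> \<in> \<Delta>"
  shows "ev_poly (CL_coeff b \<phi> \<alpha> \<beta>) (- (l + \<mu>)) l * ev_poly (F (\<alpha> + \<beta>) \<gamma>) d (l + \<mu>) =
    ev_poly (F \<beta> \<gamma>) (d + l) \<mu> * ev_poly (F \<alpha> (\<beta> + \<gamma>)) d l
    - ev_poly (F \<alpha> \<gamma>) (d + \<mu>) l * ev_poly (F \<beta> (\<alpha> + \<gamma>)) d \<mu>"
proof -
  note gens = gen_in[OF assms(1)] gen_in[OF assms(2)] gen_in[OF assms(3)]
  define X where "X = lambda_compose free_scale inner_var (inner_var + outer_var)
    (\<lambda>x. sesqui_extend F x (gen \<gamma>)) (sesqui_extend (CL_coeff b \<phi>) (gen \<alpha>) (gen \<beta>))"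
  define Y where "Y = lambda_compose free_scale outer_var inner_var (sesqui_extend F (gen \<alpha>))
    (sesqui_extend F (gen \<beta>) (gen \<gamma>))"
  define Z where "Z = lambda_compose free_scale inner_var outer_var (sesqui_extend F (gen \<beta>))
    (sesqui_extend F (gen \<alpha>) (gen \<gamma>))"
  have "lambda_compose scale inner_var (inner_var + outer_var) (\<lambda>x. act x (comb (gen \<gamma>)))
      (CL_bracket b \<phi> (gen \<alpha>) (gen \<beta>)) = map_poly (map_poly comb) X"
    unfolding X_def map_lambda_compose[OF module_hom_comb] CL_bracket_def
    using gens by (intro lambda_compose_cong act_comb coeff_sesqui_extend_in)
  then have "map_poly (map_poly comb) X = map_poly (map_poly comb) Y - map_poly (map_poly comb) Z"
    using act_bracket[OF gens(1,2) comb_in[OF gens(3)]] act_comb_comb gens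
    by (simp add: Y_def Z_def)
  then have "coeff (coeff (map_poly (map_poly comb) X) i) j =
      coeff (coeff (map_poly (map_poly comb) Y - map_poly (map_poly comb) Z) i) j" for i j
    by simp
  then have eq: "comb (coeff (coeff X i) j + coeff (coeff Z i) j) = comb (coeff (coeff Y i) j)" for i j
    by (simp add: coeff_map_poly comb.add)
  have in_carrier: "coeff (coeff (lambda_compose free_scale s t A q) i) j \<in> free_carrier \<Delta>"
    if "\<And>k n. coeff (A (coeff q k)) n \<in> free_carrier \<Delta>" for s t A and q :: "free_elem poly" and i j
    unfolding coeff_lambda_compose[OF module_free_scale]
    by (intro alg.subspace_sum[OF subspace_free_carrier]
        alg.subspace_scale[OF subspace_free_carrier] that)
  have "coeff (coeff X i) j \<in> free_carrier \<Delta>" "coeff (coeff Y i) j \<in> free_carrier \<Delta>"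
    "coeff (coeff Z i) j \<in> free_carrier \<Delta>" for i j
    unfolding X_def Y_def Z_def by (intro in_carrier coeff_sesqui_extend_in gens)+
  then have "coeff (coeff (X + Z) i) j = coeff (coeff Y i) j" for i j
    using eq comb_eq_iff alg.subspace_add[OF subspace_free_carrier] by simp
  then have "X + Z = Y" by (intro poly_eqI)
  then have "ev_free2 (\<alpha> + \<beta> + \<gamma>) d l \<mu> X + ev_free2 (\<alpha> + \<beta> + \<gamma>) d l \<mu> Z
      = ev_free2 (\<alpha> + \<beta> + \<gamma>) d l \<mu> Y"
    by (simp flip: ev_free2_add)
  then show ?thesis
    unfolding X_def Y_def Z_def ev_act_act ev_bracket_act
    by (simp add: gen_def add_ac algebra_simps)
qed

end

lemma (in module) independent_singleton_iff: "\<not> dependent {x} \<longleftrightarrow> (\<forall>p. p *s x = 0 \<longrightarrow> p = 0)"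
proof -
  have "(\<exists>t u. finite t \<and> t \<subseteq> {x} \<and> (\<Sum>v\<in>t. u v *s v) = 0 \<and> (\<exists>v\<in>t. u v \<noteq> 0)) \<longleftrightarrow>
      (\<exists>p. p *s x = 0 \<and> p \<noteq> 0)"
  proof safe
    fix t u v assume "t \<subseteq> {x}" "(\<Sum>v\<in>t. u v *s v) = 0" "v \<in> t" "u v \<noteq> 0"
    moreover from this have "t = {x}" by blast
    ultimately show "\<exists>p. p *s x = 0 \<and> p \<noteq> 0" by auto
  next
    fix p assume "p *s x = 0" "p \<noteq> 0"
    then show "\<exists>t u. finite t \<and> t \<subseteq> {x} \<and> (\<Sum>v\<in>t. u v *s v) = 0 \<and> (\<exists>v\<in>t. u v \<noteq> 0)"
      by (intro exI[of _ "{x}"] exI[of _ "\<lambda>_. p"]) auto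
  qed
  then show ?thesis by (auto simp: dependent_explicit)
qed

lemma ex_graded_basis:
  assumes "additive_subgroup_of_complex \<Delta>"
    and graded: "graded_CL_module \<Delta> b \<phi> scale V act W"
    and "free_intermediate_series \<Delta> scale W"
  obtains m F where "graded_basis \<Delta> b \<phi> scale V act W m F"
proof -
  interpret conformal_module free_scale "free_carrier \<Delta>" "CL_bracket b \<phi>" scale V act
    using graded by (simp add: graded_CL_module_def)
  obtain m where m: "\<And>\<alpha>. \<alpha> \<in> \<Delta> \<Longrightarrow> \<not> dependent {m \<alpha>} \<and> span {m \<alpha>} = W \<alpha>"
    using assms(3) unfolding free_intermediate_series_def by metis
  have W_eq: "W \<alpha> = range (\<lambda>p. scale p (m \<alpha>))" if "\<alpha> \<in> \<Delta>" for \<alpha>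
    using m[OF that] by (simp add: span_singleton)
  have free: "p = 0" if "\<alpha> \<in> \<Delta>" "scale p (m \<alpha>) = 0" for \<alpha> p
    using m[OF that(1)] that(2) by (simp add: independent_singleton_iff)
  define F where "F \<alpha> \<gamma> = map_poly (inv (\<lambda>p. scale p (m (\<alpha> + \<gamma>)))) (act (gen \<alpha>) (m \<gamma>))" for \<alpha> \<gamma>
  have "graded_basis \<Delta> b \<phi> scale V act W m F"
  proof
    show "additive_subgroup_of_complex \<Delta>" by fact
    show "internal_direct_sum \<Delta> V W" using graded by (simp add: graded_CL_module_def)
    fix \<alpha> \<gamma> assume \<alpha>: "\<alpha> \<in> \<Delta>" and \<gamma>: "\<gamma> \<in> \<Delta>"
    have \<alpha>\<gamma>: "\<alpha> + \<gamma> \<in> \<Delta>" using assms(1) \<alpha> \<gamma> by (simp add: additive_subgroup_of_complex_def)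
    let ?s = "\<lambda>p. scale p (m (\<alpha> + \<gamma>))"
    have "inj ?s"
    proof (rule injI)
      fix p q assume "?s p = ?s q"
      then have "scale (p - q) (m (\<alpha> + \<gamma>)) = 0" by (simp add: scale_left_diff_distrib)
      then show "p = q" using free[OF \<alpha>\<gamma>] by fastforce
    qed
    from inv_f_f[OF this, of 0] have "inv ?s 0 = 0" by simp
    moreover have "scale 1 (m \<gamma>) \<in> W \<gamma>" using W_eq[OF \<gamma>] by blast
    then have "coeff (act (gen \<alpha>) (m \<gamma>)) n \<in> range ?s" for n
      using graded \<alpha> \<gamma> unfolding graded_CL_module_def W_eq[OF \<alpha>\<gamma>, symmetric] scale_one by blast
    then have "?s (inv ?s (coeff (act (gen \<alpha>) (m \<gamma>)) n)) = coeff (act (gen \<alpha>) (m \<gamma>)) n" for n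
      by (rule f_inv_into_f)
    ultimately show "act (gen \<alpha>) (m \<gamma>) = map_poly ?s (F \<alpha> \<gamma>)"
      by (intro poly_eqI) (simp add: F_def coeff_map_poly)
  qed (fact W_eq free)+
  then show thesis by (rule that)
qed

lemma (in graded_basis) rescale:
  assumes \<kappa>: "\<And>\<gamma>. \<gamma> \<in> \<Delta> \<Longrightarrow> \<kappa> \<gamma> \<noteq> 0"
  shows "graded_basis \<Delta> b \<phi> scale V act W (\<lambda>\<gamma>. scale [:\<kappa> \<gamma>:] (m \<gamma>))
    (\<lambda>\<alpha> \<gamma>. cst (\<kappa> \<gamma> / \<kappa> (\<alpha> + \<gamma>)) * F \<alpha> \<gamma>)"
proof
  fix \<alpha> \<gamma> p assume \<alpha>: "\<alpha> \<in> \<Delta>"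
  have "\<exists>q'. q = q' * [:\<kappa> \<alpha>:]" for q
    using \<kappa>[OF \<alpha>] by (intro exI[of _ "q * [:1 / \<kappa> \<alpha>:]"]) simp
  then show "W \<alpha> = range (\<lambda>p. scale p (scale [:\<kappa> \<alpha>:] (m \<alpha>)))"
    unfolding W_eq[OF \<alpha>] scale_scale by (auto, metis rangeI)
  show "p = 0" if "scale p (scale [:\<kappa> \<alpha>:] (m \<alpha>)) = 0"
    using free[OF \<alpha>, of "p * [:\<kappa> \<alpha>:]"] that \<kappa>[OF \<alpha>] by simp
  assume \<gamma>: "\<gamma> \<in> \<Delta>"
  have "m \<gamma> \<in> V" using comb_in[OF gen_in[OF \<gamma>]] by (simp add: comb_gen)
  then show "act (gen \<alpha>) (scale [:\<kappa> \<gamma>:] (m \<gamma>)) = map_poly (\<lambda>p. scale p (scale [:\<kappa> (\<alpha> + \<gamma>):] (m (\<alpha> + \<gamma>))))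
      (cst (\<kappa> \<gamma> / \<kappa> (\<alpha> + \<gamma>)) * F \<alpha> \<gamma>)"
    using \<kappa>[OF add_closed[OF \<alpha> \<gamma>]]
    by (intro poly_eqI)
      (simp add: act_cscale_right gen_in \<alpha> \<gamma> act_gen coeff_map_poly cst_def smult_smult mult.commute)
qed (fact subgroup direct_sum)+

section \<open>The action of the Virasoro element\<close>

text \<open>The functional equation of \<open>structure_identity\<close> after the substitution that removes \<open>\<phi>\<close>.\<close>

locale structure_family =
  fixes \<Delta> :: "complex set" and b :: complex and P :: "complex \<Rightarrow> complex \<Rightarrow> complex poly poly"
  assumes subgroup: "additive_subgroup_of_complex \<Delta>" and b: "2 * b \<notin> \<Delta>"
    and identity: "\<alpha> \<in> \<Delta> \<Longrightarrow> \<beta> \<in> \<Delta> \<Longrightarrow> \<gamma> \<in> \<Delta> \<Longrightarrow>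
      ((\<beta> + b) * l - (\<alpha> + b) * m) * ev_poly (P (\<alpha> + \<beta>) \<gamma>) d (l + m) =
      ev_poly (P \<beta> \<gamma>) (d + l) m * ev_poly (P \<alpha> (\<beta> + \<gamma>)) d l
      - ev_poly (P \<alpha> \<gamma>) (d + m) l * ev_poly (P \<beta> (\<alpha> + \<gamma>)) d m"
begin

lemma zero_in: "0 \<in> \<Delta>" and minus_in: "\<alpha> \<in> \<Delta> \<Longrightarrow> - \<alpha> \<in> \<Delta>"
  and add_in: "\<alpha> \<in> \<Delta> \<Longrightarrow> \<beta> \<in> \<Delta> \<Longrightarrow> \<alpha> + \<beta> \<in> \<Delta>"
  using subgroup by (auto simp: additive_subgroup_of_complex_def)

lemma diff_in: "\<alpha> \<in> \<Delta> \<Longrightarrow> \<beta> \<in> \<Delta> \<Longrightarrow> \<alpha> - \<beta> \<in> \<Delta>"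
  using add_in[of \<alpha> "- \<beta>"] minus_in[of \<beta>] by simp

lemma b_notin: "b \<notin> \<Delta>"
  using add_in[of b b] b by auto

lemma b_nz: "b \<noteq> 0"
  using b_notin zero_in by auto

lemma shift_nz: "\<alpha> \<in> \<Delta> \<Longrightarrow> \<alpha> + b \<noteq> 0" "\<alpha> \<in> \<Delta> \<Longrightarrow> b - \<alpha> \<noteq> 0"
  using b_notin minus_in[of \<alpha>] by (auto simp: eq_neg_iff_add_eq_0[symmetric] add.commute)

lemma virasoro_action:
  assumes "\<gamma> \<in> \<Delta>" "P 0 \<gamma> \<noteq> 0"
  obtains c q where "\<And>d l. ev_poly (P 0 \<gamma>) d l = b * (d + c + q * l)"
proof -
  have "b * (l - m) * ev_poly (P 0 \<gamma>) d (l + m) = ev_poly (P 0 \<gamma>) (d + l) m * ev_poly (P 0 \<gamma>) d l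
      - ev_poly (P 0 \<gamma>) (d + m) l * ev_poly (P 0 \<gamma>) d m" for d l m
    using identity[OF zero_in zero_in assms(1), of l m d] by (simp add: right_diff_distrib)
  from virasoro_rank_one[OF b_nz assms(2) this] that show thesis by blast
qed

text \<open>If \<open>P \<beta> \<gamma> = 0\<close>, the equation for \<open>[x\<^bsub>-\<beta>\<^esub>, x\<^sub>\<beta>]\<close> expresses \<open>((\<beta> + b) l + (\<beta> - b) m) P 0 \<gamma>(d, l + m)\<close> as a
  single product. For \<open>d = -c - m\<close> this product is \<open>f(l) g(m)\<close>, whereas the left-hand side, which is
  \<open>b ((\<beta> + b) l + (\<beta> - b) m) (q l + (q - 1) m)\<close>, does not separate because \<open>\<beta> \<noteq> \<plusminus>b\<close>.\<close>

lemma nonzero_from_virasoro: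
  assumes \<beta>: "\<beta> \<in> \<Delta>" and \<gamma>: "\<gamma> \<in> \<Delta>" and "P 0 \<gamma> \<noteq> 0"
  shows "P \<beta> \<gamma> \<noteq> 0"
proof
  assume zero: "P \<beta> \<gamma> = 0"
  obtain c q where P0: "\<And>d l. ev_poly (P 0 \<gamma>) d l = b * (d + c + q * l)"
    using virasoro_action assms by blast
  define a a' where "a = \<beta> + b" and "a' = \<beta> - b"
  have nz: "a \<noteq> 0" "a' \<noteq> 0" using shift_nz[OF \<beta>] by (auto simp: a_def a'_def)
  define f where "f l = - ev_poly (P (- \<beta>) \<gamma>) (- c) l / b" for l
  define g where "g m = ev_poly (P \<beta> (\<gamma> - \<beta>)) (- c - m) m" for m
  have K: "(a * l + a' * m) * (q * l + (q - 1) * m) = f l * g m" for l m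
  proof -
    have "((\<beta> + b) * l - (- \<beta> + b) * m) * (b * ((- c - m) + c + q * (l + m)))
        = - (ev_poly (P (- \<beta>) \<gamma>) (- c) l * ev_poly (P \<beta> (\<gamma> - \<beta>)) (- c - m) m)"
      using identity[OF minus_in[OF \<beta>] \<beta> \<gamma>, of l m "- c - m"] by (simp add: zero P0)
    then have "b * ((a * l + a' * m) * (q * l + (q - 1) * m)) = b * (f l * g m)"
      using b_nz by (simp add: a_def a'_def f_def g_def algebra_simps)
    then show ?thesis using b_nz by simp
  qed
  \<comment> \<open>A separated function has vanishing \<open>2 \<times> 2\<close> minors; three of them give the contradiction.\<close>
  have rank_one: "(f l * g m) * (f l' * g m') = (f l * g m') * (f l' * g m)" for l l' m m'
    by simp
  have "a * a' * (q * (q - 1)) = 0"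
    using rank_one[of 0 0 1 1] unfolding K[symmetric] by (simp add: algebra_simps)
  with nz consider "q = 0" | "q = 1" by auto
  then have "a * a' = 0"
  proof cases
    case 1
    then show ?thesis using rank_one[of 0 1 1 2] unfolding K[symmetric] by (simp add: algebra_simps)
  next
    case 2
    then show ?thesis using rank_one[of 1 0 2 1] unfolding K[symmetric] by (simp add: algebra_simps)
  qed
  with nz show False by simp
qed

text \<open>The equation for \<open>[x\<^sub>0, x\<^sub>\<beta>]\<close> at \<open>l = 0\<close> compares the actions of \<open>x\<^sub>0\<close> at \<open>\<gamma>\<close> and at \<open>\<beta> + \<gamma>\<close>, multiplied by the
  nonzero polynomial \<open>P \<beta> \<gamma>\<close>; cancelling it gives the same constant \<open>c\<close> at both indices.\<close>

lemma virasoro_propagates: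
  assumes \<beta>: "\<beta> \<in> \<Delta>" and \<gamma>: "\<gamma> \<in> \<Delta>" and P0: "\<And>d l. ev_poly (P 0 \<gamma>) d l = b * (d + c + q * l)"
  shows "\<exists>q'. \<forall>d l. ev_poly (P 0 (\<beta> + \<gamma>)) d l = b * (d + c + q' * l)"
proof -
  have "P 0 \<gamma> \<noteq> 0"
    using P0[of "1 - c" 0] b_nz by auto
  then have nz: "P \<beta> \<gamma> \<noteq> 0"
    by (rule nonzero_from_virasoro[OF \<beta> \<gamma>])
  have L0: "- b * m * ev_poly (P \<beta> \<gamma>) d m =
      (ev_poly (P 0 (\<beta> + \<gamma>)) d 0 - b * (d + c + m)) * ev_poly (P \<beta> \<gamma>) d m" for d m
    using identity[OF zero_in \<beta> \<gamma>, of 0 m d] P0 by (simp add: algebra_simps)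
  have *: "ev_poly (P 0 (\<beta> + \<gamma>)) d 0 = b * (d + c)" for d
  proof -
    obtain A where A: "\<And>d m. ev_poly A d m = ev_poly (P 0 (\<beta> + \<gamma>)) d 0"
      using ex_ev_poly_subst[of "P 0 (\<beta> + \<gamma>)" inner_var 0] by auto
    have "(A - cst b * (inner_var + cst c)) * P \<beta> \<gamma> = 0"
      using L0 by (intro ev_poly_eqI) (simp add: A algebra_simps)
    with nz have "ev_poly (A - cst b * (inner_var + cst c)) d 0 = 0" by simp
    then show ?thesis by (simp add: A)
  qed
  from this[of "1 - c"] have "P 0 (\<beta> + \<gamma>) \<noteq> 0"
    using b_nz by auto
  from virasoro_action[OF add_in[OF \<beta> \<gamma>] this] obtain c' q' where
    "\<And>d l. ev_poly (P 0 (\<beta> + \<gamma>)) d l = b * (d + c' + q' * l)" by blast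
  with *[of 0] b_nz show ?thesis by (intro exI[of _ q']) simp
qed

text \<open>If \<open>x\<^sub>0\<close> acts by zero on both \<open>M\<^sub>\<gamma>\<close> and \<open>M\<^bsub>\<alpha>+\<gamma>\<^esub>\<close>, then so does its commutator with \<open>x\<^sub>\<alpha>\<close> on
  \<open>M\<^sub>\<gamma>\<close>, which is a nonzero multiple of \<open>P \<alpha> \<gamma>\<close>.\<close>

lemma virasoro_nontrivial:
  assumes \<alpha>: "\<alpha> \<in> \<Delta>" and \<gamma>: "\<gamma> \<in> \<Delta>" and nz: "P \<alpha> \<gamma> \<noteq> 0"
  shows "\<exists>\<delta>\<in>\<Delta>. P 0 \<delta> \<noteq> 0"
proof (rule ccontr)
  assume "\<not> ?thesis"
  then have zero: "P 0 \<gamma> = 0" "P 0 (\<alpha> + \<gamma>) = 0" using \<gamma> add_in[OF \<alpha> \<gamma>] by auto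
  have "((\<alpha> + b) * l - b * m) * ev_poly (P \<alpha> \<gamma>) d (l + m) = 0" for l m d
    using identity[OF zero_in \<alpha> \<gamma>] by (simp add: zero)
  from this[of _ 0] have "(\<alpha> + b) * l * ev_poly (P \<alpha> \<gamma>) d l = 0" for l d
    by simp
  then have "(cst (\<alpha> + b) * outer_var) * P \<alpha> \<gamma> = 0"
    by (intro ev_poly_eqI) simp
  with nz have "cst (\<alpha> + b) * outer_var = 0" by (metis mult_eq_0_iff)
  from arg_cong[OF this, of "\<lambda>Q. ev_poly Q 0 1"] shift_nz(1)[OF \<alpha>] show False by simp
qed

lemma virasoro_weights:
  assumes "\<alpha> \<in> \<Delta>" "\<gamma> \<in> \<Delta>" "P \<alpha> \<gamma> \<noteq> 0"
  obtains c q where "\<And>\<delta> d l. \<delta> \<in> \<Delta> \<Longrightarrow> ev_poly (P 0 \<delta>) d l = b * (d + c + q \<delta> * l)"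
proof -
  obtain \<delta>0 where \<delta>0: "\<delta>0 \<in> \<Delta>" "P 0 \<delta>0 \<noteq> 0" using virasoro_nontrivial[OF assms] by blast
  obtain c q0 where *: "\<And>d l. ev_poly (P 0 \<delta>0) d l = b * (d + c + q0 * l)"
    using virasoro_action[OF \<delta>0] by blast
  have "\<exists>q'. \<forall>d l. ev_poly (P 0 \<delta>) d l = b * (d + c + q' * l)" if "\<delta> \<in> \<Delta>" for \<delta>
    using virasoro_propagates[OF diff_in[OF that \<delta>0(1)] \<delta>0(1) *] by simp
  then show thesis using that by metis
qed

end

section \<open>Classification of the weights\<close>

text \<open>The solutions of \<open>virasoro_identity\<close> below of degree \<open>k\<close> at most 2 with leading coefficient 1, in terms of
  \<open>s = \<beta>/b + 1\<close> and the target weight \<open>q\<close>. For \<open>k = 2\<close> they are solutions only for special weights.\<close>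

definition intertwiner :: "nat \<Rightarrow> complex \<Rightarrow> complex \<Rightarrow> complex \<Rightarrow> complex \<Rightarrow> complex" where
  "intertwiner k s q d l =
     (if k = 0 then 1
      else if k = 1 then d + q / s * l
      else d\<^sup>2 + (1 + 2 * q) / s * d * l + q / s * l\<^sup>2)"

locale weighted_structure_family = structure_family +
  fixes q :: "complex \<Rightarrow> complex"
  assumes P0: "\<gamma> \<in> \<Delta> \<Longrightarrow> ev_poly (P 0 \<gamma>) d l = b * (d + q \<gamma> * l)"
begin

lemma P_nz:
  assumes "\<beta> \<in> \<Delta>" "\<gamma> \<in> \<Delta>"
  shows "P \<beta> \<gamma> \<noteq> 0"
proof (rule nonzero_from_virasoro[OF assms])
  show "P 0 \<gamma> \<noteq> 0" using P0[OF assms(2), of 1 0] b_nz by auto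
qed

lemma virasoro_identity:
  assumes \<beta>: "\<beta> \<in> \<Delta>" and \<gamma>: "\<gamma> \<in> \<Delta>"
  shows "((\<beta> / b + 1) * l - m) * ev_poly (P \<beta> \<gamma>) d (l + m) =
    (d + q (\<beta> + \<gamma>) * l) * ev_poly (P \<beta> \<gamma>) (d + l) m - (d + m + q \<gamma> * l) * ev_poly (P \<beta> \<gamma>) d m"
proof -
  have "b * (((\<beta> / b + 1) * l - m) * ev_poly (P \<beta> \<gamma>) d (l + m)) = b *
    ((d + q (\<beta> + \<gamma>) * l) * ev_poly (P \<beta> \<gamma>) (d + l) m - (d + m + q \<gamma> * l) * ev_poly (P \<beta> \<gamma>) d m)"
    using identity[OF zero_in \<beta> \<gamma>, of l m d] P0[OF \<gamma>] P0[OF add_in[OF \<beta> \<gamma>]] b_nz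
    by (simp add: algebra_simps)
  with b_nz show ?thesis by simp
qed

text \<open>The \<open>l\<close>-derivative of \<open>virasoro_identity\<close> at \<open>l = 0\<close> is Euler's equation.\<close>

lemma homogeneous:
  assumes \<beta>: "\<beta> \<in> \<Delta>" and \<gamma>: "\<gamma> \<in> \<Delta>"
  obtains k x where "1 + \<beta> / b + q \<gamma> - q (\<beta> + \<gamma>) = of_nat k"
    and "\<And>d l. ev_poly (P \<beta> \<gamma>) d l = (\<Sum>j\<le>k. x j * d ^ (k - j) * l ^ j)"
proof -
  let ?X = "ev_poly (P \<beta> \<gamma>)" and ?x = "ev_poly (map_poly pderiv (P \<beta> \<gamma>))" and ?y = "ev_poly (pderiv (P \<beta> \<gamma>))"
  have "d * ?x d m + m * ?y d m = (1 + \<beta> / b + q \<gamma> - q (\<beta> + \<gamma>)) * ?X d m" for d m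
  proof -
    have "((\<lambda>l. ((\<beta> / b + 1) * l - m) * ?X d (l + m)) has_field_derivative
        (\<beta> / b + 1) * ?X d m - m * ?y d m) (at 0)"
      by (rule derivative_eq_intros refl)+ simp
    moreover have "((\<lambda>l. (d + q (\<beta> + \<gamma>) * l) * ?X (d + l) m - (d + m + q \<gamma> * l) * ?X d m)
        has_field_derivative d * ?x d m + q (\<beta> + \<gamma>) * ?X d m - q \<gamma> * ?X d m) (at 0)"
      by (rule derivative_eq_intros refl)+ simp
    ultimately have "(\<beta> / b + 1) * ?X d m - m * ?y d m =
        d * ?x d m + q (\<beta> + \<gamma>) * ?X d m - q \<gamma> * ?X d m"
      unfolding virasoro_identity[OF assms] by (rule DERIV_unique)
    then show ?thesis by (simp add: algebra_simps)
  qed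
  from euler_homogeneous[OF this P_nz[OF assms]] that show thesis by blast
qed

text \<open>The degree of \<open>P \<beta> \<gamma>\<close>; it exists by \<open>homogeneous\<close>.\<close>

definition deg :: "complex \<Rightarrow> complex \<Rightarrow> nat" where
  "deg \<beta> \<gamma> = (THE k. of_nat k = 1 + \<beta> / b + q \<gamma> - q (\<beta> + \<gamma>))"

lemma of_nat_deg:
  assumes "\<beta> \<in> \<Delta>" "\<gamma> \<in> \<Delta>"
  shows "of_nat (deg \<beta> \<gamma>) = 1 + \<beta> / b + q \<gamma> - q (\<beta> + \<gamma>)"
proof -
  obtain k where "of_nat k = 1 + \<beta> / b + q \<gamma> - q (\<beta> + \<gamma>)" using homogeneous[OF assms] by metis
  then show ?thesis unfolding deg_def by (rule theI) (metis \<open>of_nat k = _\<close> of_nat_eq_iff)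
qed

text \<open>The degrees of the maps \<open>x\<^sub>\<beta>\<close> from \<open>\<gamma>\<close> to \<open>\<beta> + \<gamma>\<close> and \<open>x\<^bsub>-\<beta>\<^esub>\<close> back add up to 2.\<close>

lemma deg_le_2:
  assumes "\<beta> \<in> \<Delta>" "\<gamma> \<in> \<Delta>"
  shows "deg \<beta> \<gamma> \<le> 2"
proof -
  have "of_nat (deg \<beta> \<gamma>) + of_nat (deg (- \<beta>) (\<beta> + \<gamma>)) = (2 :: complex)"
    using assms by (simp add: of_nat_deg add_in minus_in)
  then have "of_nat (deg \<beta> \<gamma> + deg (- \<beta>) (\<beta> + \<gamma>)) = (of_nat 2 :: complex)" by simp
  then show ?thesis unfolding of_nat_eq_iff by simp
qed

text \<open>With unknown coefficients, \<open>virasoro_identity\<close> becomes a linear system, and a few integer points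
  isolate its equations. In degree 2 the system is overdetermined: it has a nonzero solution only if
  \<open>q' (s - 1 - q') = 0\<close>, which is the condition on the weights.\<close>

lemma normal_form:
  assumes \<beta>: "\<beta> \<in> \<Delta>" and \<gamma>: "\<gamma> \<in> \<Delta>"
  obtains x where "x \<noteq> 0"
    and "\<And>d l. ev_poly (P \<beta> \<gamma>) d l = (\<beta> + b) * x * intertwiner (deg \<beta> \<gamma>) (\<beta> / b + 1) (q (\<beta> + \<gamma>)) d l"
    and "deg \<beta> \<gamma> = 2 \<Longrightarrow> q (\<beta> + \<gamma>) = 0 \<or> q \<gamma> = 1"
proof -
  obtain k y where k: "1 + \<beta> / b + q \<gamma> - q (\<beta> + \<gamma>) = of_nat k"
    and y: "\<And>d l. ev_poly (P \<beta> \<gamma>) d l = (\<Sum>j\<le>k. y j * d ^ (k - j) * l ^ j)"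
    using homogeneous[OF assms] by blast
  have deg: "deg \<beta> \<gamma> = k" using k of_nat_deg[OF assms] by (metis of_nat_eq_iff)
  have nz: "P \<beta> \<gamma> \<noteq> 0" by (rule P_nz[OF assms])
  define s q' where "s = \<beta> / b + 1" and "q' = q (\<beta> + \<gamma>)"
  have s: "s \<noteq> 0" using shift_nz(1)[OF \<beta>] b_nz by (simp add: s_def field_simps)
  have q\<gamma>: "q \<gamma> = of_nat k - s + q'" using k by (simp add: s_def q'_def algebra_simps)
  note id = virasoro_identity[OF assms, folded s_def q'_def, unfolded q\<gamma>]
  have "\<exists>z. z \<noteq> 0 \<and> (\<forall>d l. ev_poly (P \<beta> \<gamma>) d l = z * intertwiner k s q' d l) \<and>
      (k = 2 \<longrightarrow> q' = 0 \<or> q \<gamma> = 1)"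
  proof -
    have "k \<le> 2" using deg_le_2[OF assms] deg by simp
    then consider "k = 0" | "k = 1" | "k = 2" by linarith
    then show ?thesis
    proof cases
      case 1
      then have P: "ev_poly (P \<beta> \<gamma>) d l = y 0" for d l by (simp add: y)
      then have "y 0 \<noteq> 0" using nz ev_poly_eqI[of "P \<beta> \<gamma>" 0] by auto
      then show ?thesis using 1 P by (intro exI[of _ "y 0"]) (simp add: intertwiner_def)
    next
      case 2
      then have P: "ev_poly (P \<beta> \<gamma>) d l = y 0 * d + y 1 * l" for d l by (simp add: y)
      have "s * y 1 = q' * y 0"
        using id[of 1 0 0] 2 by (simp add: P)
      then have y1: "y 1 = y 0 * (q' / s)" using s by (simp add: field_simps)
      then have P: "ev_poly (P \<beta> \<gamma>) d l = y 0 * (d + q' / s * l)" for d l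
        by (simp add: P y1 algebra_simps)
      then have "y 0 \<noteq> 0" using nz ev_poly_eqI[of "P \<beta> \<gamma>" 0] by auto
      then show ?thesis using 2 P by (intro exI[of _ "y 0"]) (simp add: intertwiner_def)
    next
      case 3
      then have P: "ev_poly (P \<beta> \<gamma>) d l = y 0 * d\<^sup>2 + y 1 * d * l + y 2 * l\<^sup>2" for d l
        by (simp add: y numeral_2_eq_2)
      have y2: "s * y 2 = q' * y 0"
        using id[of 1 0 0] 3 by (simp add: P)
      have "s * (y 0 + y 1 + y 2) = (1 + q') * (y 0 * 4) - (3 + (q' - s)) * y 0"
        "s * (y 0 - y 1 + y 2) = (s - q' - 1) * y 0"
        using id[of 1 0 1] id[of "-1" 0 1] 3 by (simp_all add: P)
      then have "2 * (s * y 1) = 2 * ((1 + 2 * q') * y 0)" by algebra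
      then have y1: "s * y 1 = (1 + 2 * q') * y 0" by simp
      have "(s - 1) * (y 2 * 4) = q' * (y 0 + y 1 + y 2) - (3 + (q' - s)) * y 2"
        "q' * (y 0 - y 1 + y 2) = (1 + (q' - s)) * y 2"
        using id[of 1 1 0] id[of 1 "-1" 0] 3 by (simp_all add: P)
      then have "2 * ((2 * s - 1) * y 2) = 2 * (q' * y 1)" by algebra
      then have "(2 * s - 1) * y 2 = q' * y 1" by simp
      then have "(2 * s - 1) * (s * y 2) = q' * (s * y 1)" by algebra
      then have "2 * (q' * (s - 1 - q') * y 0) = 0"
        unfolding y1 y2 by (simp add: algebra_simps)
      then have *: "q' * (s - 1 - q') * y 0 = 0" by simp
      have y12: "y 1 = y 0 * ((1 + 2 * q') / s)" "y 2 = y 0 * (q' / s)"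
        using s y1 y2 by (simp_all add: field_simps)
      have P: "ev_poly (P \<beta> \<gamma>) d l = y 0 * (d\<^sup>2 + (1 + 2 * q') / s * d * l + q' / s * l\<^sup>2)" for d l
        unfolding P y12 by (simp add: algebra_simps)
      then have "y 0 \<noteq> 0" using nz ev_poly_eqI[of "P \<beta> \<gamma>" 0] by auto
      moreover have "q' = 0 \<or> q \<gamma> = 1"
        using * \<open>y 0 \<noteq> 0\<close> q\<gamma> 3 by auto
      ultimately show ?thesis using 3 P by (intro exI[of _ "y 0"]) (simp add: intertwiner_def)
    qed
  qed
  then obtain z where "z \<noteq> 0" "\<And>d l. ev_poly (P \<beta> \<gamma>) d l = z * intertwiner k s q' d l"
    "k = 2 \<Longrightarrow> q' = 0 \<or> q \<gamma> = 1" by blast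
  then show thesis
    using shift_nz(1)[OF \<beta>] by (intro that[of "z / (\<beta> + b)"]) (simp_all add: deg s_def q'_def)
qed

text \<open>Put \<open>r \<gamma> = q \<gamma> - \<gamma>/b\<close>. Since degrees lie in \<open>{0, 1, 2}\<close>, values of \<open>r\<close> differ by at most 1, and
  \<open>r \<gamma> = r \<delta> + 1\<close> requires \<open>q \<delta> = 0\<close> or \<open>q \<gamma> = 1\<close>. On each level set of \<open>r\<close> the weight \<open>q\<close> is injective, so if
  both values occur, \<open>q \<delta> = 0\<close> holds for at most one \<open>\<delta>\<close> in the lower set and \<open>q \<gamma> = 1\<close> for at most one \<open>\<gamma>\<close> in the
  upper set; therefore the lower set is some \<open>{\<delta>}\<close> with \<open>q \<delta> = 0\<close> or the upper set is some \<open>{\<gamma>}\<close> with \<open>q \<gamma> = 1\<close>.\<close>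

lemma weights_classification:
  obtains (line) e where "\<And>\<gamma>. \<gamma> \<in> \<Delta> \<Longrightarrow> q \<gamma> = e + \<gamma> / b"
  | (A1) \<gamma>0 where "\<gamma>0 \<in> \<Delta>" "q \<gamma>0 = 0" "\<And>\<alpha>. \<alpha> \<in> \<Delta> \<Longrightarrow> \<alpha> \<noteq> 0 \<Longrightarrow> q (\<alpha> + \<gamma>0) = 1 + \<alpha> / b"
  | (A2) \<gamma>0 where "\<gamma>0 \<in> \<Delta>" "q \<gamma>0 = 1" "\<And>\<alpha>. \<alpha> \<in> \<Delta> \<Longrightarrow> \<alpha> \<noteq> 0 \<Longrightarrow> q (\<alpha> + \<gamma>0) = \<alpha> / b"
proof -
  define r where "r \<gamma> = q \<gamma> - \<gamma> / b" for \<gamma>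
  have r_diff: "r \<gamma> - r \<delta> = -1 \<or> r \<gamma> - r \<delta> = 0 \<or> r \<gamma> - r \<delta> = 1"
    and special: "r \<gamma> = r \<delta> + 1 \<Longrightarrow> q \<delta> = 0 \<or> q \<gamma> = 1"
    if "\<gamma> \<in> \<Delta>" "\<delta> \<in> \<Delta>" for \<gamma> \<delta>
  proof -
    have in_\<Delta>: "\<delta> - \<gamma> \<in> \<Delta>" using that diff_in by blast
    have k: "of_nat (deg (\<delta> - \<gamma>) \<gamma>) = 1 + (r \<gamma> - r \<delta>)"
      using of_nat_deg[OF in_\<Delta> that(1)] b_nz by (simp add: r_def diff_divide_distrib)
    have "deg (\<delta> - \<gamma>) \<gamma> \<le> 2" by (rule deg_le_2[OF in_\<Delta> that(1)])
    then consider "deg (\<delta> - \<gamma>) \<gamma> = 0" | "deg (\<delta> - \<gamma>) \<gamma> = 1" | "deg (\<delta> - \<gamma>) \<gamma> = 2" by linarith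
    then show "r \<gamma> - r \<delta> = -1 \<or> r \<gamma> - r \<delta> = 0 \<or> r \<gamma> - r \<delta> = 1"
      using k by cases (auto simp: algebra_simps eq_neg_iff_add_eq_0)
    assume "r \<gamma> = r \<delta> + 1"
    with k have "of_nat (deg (\<delta> - \<gamma>) \<gamma>) = (of_nat 2 :: complex)" by simp
    then have "deg (\<delta> - \<gamma>) \<gamma> = 2" by (simp only: of_nat_eq_iff)
    from normal_form[OF in_\<Delta> that(1)] this show "q \<delta> = 0 \<or> q \<gamma> = 1" by (metis diff_add_cancel)
  qed
  show thesis
  proof (cases "\<forall>\<gamma>\<in>\<Delta>. r \<gamma> = r 0")
    case True
    then show thesis by (intro line[of "r 0"]) (metis r_def diff_add_cancel)
  next
    case False
    then obtain \<gamma>' where "\<gamma>' \<in> \<Delta>" "r \<gamma>' \<noteq> r 0" by blast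
    with r_diff[OF this(1) zero_in] obtain \<gamma> \<delta> where
      \<gamma>: "\<gamma> \<in> \<Delta>" and \<delta>: "\<delta> \<in> \<Delta>" and step: "r \<gamma> = r \<delta> + 1"
      using zero_in by (auto simp: algebra_simps eq_neg_iff_add_eq_0)
    have two: "r \<epsilon> = r \<delta> \<or> r \<epsilon> = r \<delta> + 1" if "\<epsilon> \<in> \<Delta>" for \<epsilon>
      using r_diff[OF that \<delta>] r_diff[OF that \<gamma>] step by auto
    have q: "q \<epsilon> = r \<epsilon> + \<epsilon> / b" for \<epsilon> by (simp add: r_def)
    have q_inj: "\<epsilon> = \<epsilon>'" if "r \<epsilon> = r \<epsilon>'" "q \<epsilon> = q \<epsilon>'" for \<epsilon> \<epsilon>'
      using that b_nz by (simp add: r_def)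
    show thesis
    proof (cases "\<forall>\<epsilon>\<in>\<Delta>. \<epsilon> \<noteq> \<delta> \<longrightarrow> r \<epsilon> = r \<delta> + 1")
      case True
      show thesis
      proof (cases "q \<delta> = 0")
        case q0: True
        have "q (\<alpha> + \<delta>) = 1 + \<alpha> / b" if "\<alpha> \<in> \<Delta>" "\<alpha> \<noteq> 0" for \<alpha>
          using True add_in[OF that(1) \<delta>] that(2) q[of "\<alpha> + \<delta>"] q0 q[of \<delta>]
          by (simp add: add_divide_distrib algebra_simps)
        with \<delta> q0 show thesis by (rule A1)
      next
        case False
        have unique: "\<epsilon> = \<gamma>" if "\<epsilon> \<in> \<Delta>" "r \<epsilon> = r \<delta> + 1" for \<epsilon>
          using special[OF that(1) \<delta> that(2)] special[OF \<gamma> \<delta> step] False q_inj[of \<epsilon> \<gamma>] that step by simp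
        have "q (\<alpha> + \<gamma>) = \<alpha> / b" if "\<alpha> \<in> \<Delta>" "\<alpha> \<noteq> 0" for \<alpha>
        proof -
          have "r (\<alpha> + \<gamma>) = r \<delta>" using two[OF add_in[OF that(1) \<gamma>]] unique[OF add_in[OF that(1) \<gamma>]] that(2) by auto
          then show ?thesis using special[OF \<gamma> \<delta> step] False q[of "\<alpha> + \<gamma>"] q[of \<gamma>] step
            by (simp add: add_divide_distrib algebra_simps)
        qed
        then show thesis using A2 \<gamma> special[OF \<gamma> \<delta> step] False by blast
      qed
    next
      case False
      then obtain \<epsilon> where \<epsilon>: "\<epsilon> \<in> \<Delta>" "\<epsilon> \<noteq> \<delta>" "r \<epsilon> = r \<delta>" using two by blast
      have q1: "q \<zeta> = 1" if "\<zeta> \<in> \<Delta>" "r \<zeta> = r \<delta> + 1" for \<zeta>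
        using special[OF that(1) \<delta> that(2)] special[of \<zeta> \<epsilon>] \<epsilon> that q_inj[of \<epsilon> \<delta>] by auto
      have unique: "\<zeta> = \<gamma>" if "\<zeta> \<in> \<Delta>" "r \<zeta> = r \<delta> + 1" for \<zeta>
        using q1[OF that] q1[OF \<gamma> step] q_inj[of \<zeta> \<gamma>] that step by simp
      have "q (\<alpha> + \<gamma>) = \<alpha> / b" if "\<alpha> \<in> \<Delta>" "\<alpha> \<noteq> 0" for \<alpha>
      proof -
        have "r (\<alpha> + \<gamma>) = r \<delta>" using two[OF add_in[OF that(1) \<gamma>]] unique[OF add_in[OF that(1) \<gamma>]] that(2) by auto
        then show ?thesis using q1[OF \<gamma> step] q[of "\<alpha> + \<gamma>"] q[of \<gamma>] step
          by (simp add: add_divide_distrib algebra_simps)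
      qed
      then show thesis using A2 \<gamma> q1[OF \<gamma> step] by blast
    qed
  qed
qed

end

section \<open>Normalisation of the generators\<close>

lemma intertwiner_at_0 [simp]: "k \<le> 2 \<Longrightarrow> intertwiner k s q d 0 = d ^ k"
  by (auto simp: intertwiner_def numeral_2_eq_2 le_Suc_eq)

lemma intertwiner_derivative:
  assumes "k \<le> 2"
  shows "((\<lambda>l. intertwiner k s q 1 l) has_field_derivative
    (of_nat k * q + of_nat k * (of_nat k - 1) / 2) / s) (at 0)"
proof -
  consider "k = 0" | "k = 1" | "k = 2" using assms by linarith
  then show ?thesis
  proof cases
    case 1
    then show ?thesis by (simp add: intertwiner_def)
  next
    case 2
    have "((\<lambda>l. 1 + q / s * l) has_field_derivative q / s) (at 0)"
      by (rule derivative_eq_intros refl)+ simp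
    with 2 show ?thesis by (simp add: intertwiner_def)
  next
    case 3
    have "((\<lambda>l. 1 + (1 + 2 * q) / s * l + q / s * l\<^sup>2) has_field_derivative (1 + 2 * q) / s) (at 0)"
      by (rule derivative_eq_intros refl)+ simp
    with 3 show ?thesis by (simp add: intertwiner_def add.commute)
  qed
qed

context weighted_structure_family
begin

lemma deg_eqI:
  assumes "\<beta> \<in> \<Delta>" "\<gamma> \<in> \<Delta>" "1 + \<beta> / b + q \<gamma> - q (\<beta> + \<gamma>) = of_nat k"
  shows "deg \<beta> \<gamma> = k"
  using of_nat_deg[OF assms(1,2)] assms(3) by (metis of_nat_eq_iff)

text \<open>The leading coefficient in \<open>\<partial>\<close>, relative to the factor \<open>\<beta> + b\<close> that the models carry; it is obtained at
  \<open>\<partial> = 1\<close>, \<open>\<lambda> = 0\<close> because \<open>P \<beta> \<gamma>\<close> is homogeneous.\<close>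

definition lead :: "complex \<Rightarrow> complex \<Rightarrow> complex" where
  "lead \<beta> \<gamma> = ev_poly (P \<beta> \<gamma>) 1 0 / (\<beta> + b)"

lemma lead_nz: "\<beta> \<in> \<Delta> \<Longrightarrow> \<gamma> \<in> \<Delta> \<Longrightarrow> lead \<beta> \<gamma> \<noteq> 0"
  and P_eq: "\<beta> \<in> \<Delta> \<Longrightarrow> \<gamma> \<in> \<Delta> \<Longrightarrow> ev_poly (P \<beta> \<gamma>) d l =
    (\<beta> + b) * lead \<beta> \<gamma> * intertwiner (deg \<beta> \<gamma>) (\<beta> / b + 1) (q (\<beta> + \<gamma>)) d l"
proof -
  assume in_\<Delta>: "\<beta> \<in> \<Delta>" "\<gamma> \<in> \<Delta>"
  obtain x where x: "x \<noteq> 0"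
    "\<And>d l. ev_poly (P \<beta> \<gamma>) d l = (\<beta> + b) * x * intertwiner (deg \<beta> \<gamma>) (\<beta> / b + 1) (q (\<beta> + \<gamma>)) d l"
    using normal_form[OF in_\<Delta>] by metis
  then have "lead \<beta> \<gamma> = x"
    using shift_nz(1)[OF in_\<Delta>(1)] deg_le_2[OF in_\<Delta>] by (simp add: lead_def)
  with x show "lead \<beta> \<gamma> \<noteq> 0" "ev_poly (P \<beta> \<gamma>) d l =
    (\<beta> + b) * lead \<beta> \<gamma> * intertwiner (deg \<beta> \<gamma>) (\<beta> / b + 1) (q (\<beta> + \<gamma>)) d l" by auto
qed

text \<open>In the functional equation at \<open>d = 1\<close>, \<open>m = 0\<close> the constant term in \<open>l\<close> shows that both products on the
  right have the same leading coefficient, and the linear term then relates it to \<open>lead (\<alpha> + \<beta>) \<gamma>\<close>. The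
  factors \<open>k1\<close>, \<open>k2\<close>, \<open>k3\<close> are degrees; \<open>(k q + k (k - 1)/2)/s\<close> is the coefficient of \<open>d\<^bsup>k-1\<^esup> l\<close> in \<open>intertwiner\<close>.\<close>

lemma lead_cocycle:
  assumes \<alpha>: "\<alpha> \<in> \<Delta>" and \<beta>: "\<beta> \<in> \<Delta>" and \<gamma>: "\<gamma> \<in> \<Delta>"
  defines "k1 \<equiv> 1 + \<beta> / b + q \<gamma> - q (\<beta> + \<gamma>)"
    and "k2 \<equiv> 1 + \<alpha> / b + q (\<beta> + \<gamma>) - q (\<alpha> + \<beta> + \<gamma>)"
    and "k3 \<equiv> 1 + \<alpha> / b + q \<gamma> - q (\<alpha> + \<gamma>)"
  shows "(\<alpha> + \<beta> + b) * lead (\<alpha> + \<beta>) \<gamma> = lead \<beta> \<gamma> * lead \<alpha> (\<beta> + \<gamma>) *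
    ((\<alpha> + b) * k1 + b * (k2 * q (\<alpha> + \<beta> + \<gamma>) + k2 * (k2 - 1) / 2 - k3 * q (\<alpha> + \<gamma>) - k3 * (k3 - 1) / 2))"
proof -
  have \<alpha>\<beta>: "\<alpha> + \<beta> \<in> \<Delta>" and \<alpha>\<gamma>: "\<alpha> + \<gamma> \<in> \<Delta>" and \<beta>\<gamma>: "\<beta> + \<gamma> \<in> \<Delta>"
    using add_in \<alpha> \<beta> \<gamma> by auto
  have k: "k1 = of_nat (deg \<beta> \<gamma>)" "k2 = of_nat (deg \<alpha> (\<beta> + \<gamma>))" "k3 = of_nat (deg \<alpha> \<gamma>)"
    using of_nat_deg \<alpha> \<beta> \<gamma> \<beta>\<gamma> by (simp_all add: k1_def k2_def k3_def add.assoc)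
  note le = deg_le_2[OF \<beta> \<gamma>] deg_le_2[OF \<alpha> \<beta>\<gamma>] deg_le_2[OF \<alpha> \<gamma>] deg_le_2[OF \<beta> \<alpha>\<gamma>] deg_le_2[OF \<alpha>\<beta> \<gamma>]
  define s where "s = \<alpha> / b + 1"
  have s: "s \<noteq> 0" "(\<alpha> + b) / s = b" using shift_nz(1)[OF \<alpha>] b_nz by (simp_all add: s_def field_simps)
  define p p' where "p = lead \<beta> \<gamma> * lead \<alpha> (\<beta> + \<gamma>)" and "p' = lead \<alpha> \<gamma> * lead \<beta> (\<alpha> + \<gamma>)"
  let ?I3 = "intertwiner (deg (\<alpha> + \<beta>) \<gamma>) ((\<alpha> + \<beta>) / b + 1) (q (\<alpha> + \<beta> + \<gamma>)) 1"
  let ?I = "intertwiner (deg \<alpha> (\<beta> + \<gamma>)) s (q (\<alpha> + \<beta> + \<gamma>)) 1"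
  let ?I' = "intertwiner (deg \<alpha> \<gamma>) s (q (\<alpha> + \<gamma>)) 1"
  have id: "(\<alpha> + \<beta> + b) * lead (\<alpha> + \<beta>) \<gamma> * l * ?I3 l =
      (\<alpha> + b) * (p * (1 + l) ^ deg \<beta> \<gamma> * ?I l - p' * ?I' l)" for l
  proof -
    have "(\<beta> + b) * ((\<alpha> + \<beta> + b) * lead (\<alpha> + \<beta>) \<gamma> * l * ?I3 l) =
      (\<beta> + b) * ((\<alpha> + b) * (p * (1 + l) ^ deg \<beta> \<gamma> * ?I l - p' * ?I' l))"
      using identity[OF \<alpha> \<beta> \<gamma>, of l 0 1] le
      by (simp add: P_eq \<alpha> \<beta> \<gamma> \<alpha>\<beta> \<alpha>\<gamma> \<beta>\<gamma> s_def p_def p'_def add.assoc algebra_simps)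
    then show ?thesis using shift_nz(1)[OF \<beta>] by simp
  qed
  have "p' = p" using id[of 0] le shift_nz(1)[OF \<alpha>] by simp
  have "((\<lambda>l. (\<alpha> + \<beta> + b) * lead (\<alpha> + \<beta>) \<gamma> * l * ?I3 l) has_field_derivative
      (\<alpha> + \<beta> + b) * lead (\<alpha> + \<beta>) \<gamma>) (at 0)"
    by (rule derivative_eq_intros refl intertwiner_derivative[OF le(5)])+ (use le in simp)
  moreover have "((\<lambda>l. (\<alpha> + b) * (p * (1 + l) ^ deg \<beta> \<gamma> * ?I l - p' * ?I' l)) has_field_derivative
      p * ((\<alpha> + b) * k1 + (\<alpha> + b) / s * (k2 * q (\<alpha> + \<beta> + \<gamma>) + k2 * (k2 - 1) / 2
        - k3 * q (\<alpha> + \<gamma>) - k3 * (k3 - 1) / 2))) (at 0)"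
    unfolding \<open>p' = p\<close>
    by (rule derivative_eq_intros refl intertwiner_derivative[OF le(2)] intertwiner_derivative[OF le(3)])+
      (use le in \<open>simp add: k algebra_simps add_divide_distrib diff_divide_distrib\<close>)
  ultimately show ?thesis
    unfolding id s p_def by (rule DERIV_unique)
qed

text \<open>For the weights that can occur, the factor in \<open>lead_cocycle\<close> equals \<open>\<alpha> + \<beta> + b\<close>. One base point suffices for
  what follows, and at the exceptional index \<open>\<gamma>0\<close> there are the fewest cases.\<close>

lemma cocycle_at_base:
  obtains \<gamma>0 where "\<gamma>0 \<in> \<Delta>"
    and "\<And>\<alpha> \<beta>. \<alpha> \<in> \<Delta> \<Longrightarrow> \<beta> \<in> \<Delta> \<Longrightarrow> lead (\<alpha> + \<beta>) \<gamma>0 = lead \<beta> \<gamma>0 * lead \<alpha> (\<beta> + \<gamma>0)"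
proof -
  \<comment> \<open>The required equality of factors, divided by \<open>b/2\<close>, with \<open>t = \<alpha>/b\<close> and \<open>u = \<beta>/b\<close>.\<close>
  have reduce: "lead (\<alpha> + \<beta>) \<gamma> = lead \<beta> \<gamma> * lead \<alpha> (\<beta> + \<gamma>)"
    if "\<alpha> \<in> \<Delta>" "\<beta> \<in> \<Delta>" "\<gamma> \<in> \<Delta>"
      and "t = \<alpha> / b" "u = \<beta> / b" "C = q (\<alpha> + \<beta> + \<gamma>)"
      and "k1 = 1 + u + q \<gamma> - q (\<beta> + \<gamma>)"
      and "k2 = 1 + t + q (\<beta> + \<gamma>) - C"
      and "k3 = 1 + t + q \<gamma> - q (\<alpha> + \<gamma>)"
      and "2 * (t + 1) * k1 + (2 * k2 * C + k2 * (k2 - 1) - 2 * k3 * q (\<alpha> + \<gamma>) - k3 * (k3 - 1)) = 2 * (t + u + 1)"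
    for \<alpha> \<beta> \<gamma> t u C k1 k2 k3
  proof -
    have ab: "\<alpha> = b * t" "\<beta> = b * u" using that(4,5) b_nz by simp_all
    have "(\<alpha> + b) * k1 + b * (k2 * C + k2 * (k2 - 1) / 2 - k3 * q (\<alpha> + \<gamma>) - k3 * (k3 - 1) / 2) = 
      b / 2 * (2 * (t + 1) * k1 + (2 * k2 * C + k2 * (k2 - 1) - 2 * k3 * q (\<alpha> + \<gamma>) - k3 * (k3 - 1)))"
      unfolding ab(1) by (simp add: field_simps)
    also have "\<dots> = \<alpha> + \<beta> + b"
      unfolding that(10) unfolding ab by (simp add: field_simps)
    finally have "(\<alpha> + \<beta> + b) * lead (\<alpha> + \<beta>) \<gamma> = (\<alpha> + \<beta> + b) * (lead \<beta> \<gamma> * lead \<alpha> (\<beta> + \<gamma>))"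
      using lead_cocycle[OF that(1-3)] that(4-9) by (simp add: mult.commute)
    then show ?thesis using shift_nz(1)[OF add_in[OF that(1,2)]] by simp
  qed
  note div = add_divide_distrib
  show thesis
  proof (cases rule: weights_classification)
    case (line e)
    show thesis
    proof (rule that[OF zero_in])
      fix \<alpha> \<beta> assume "\<alpha> \<in> \<Delta>" "\<beta> \<in> \<Delta>"
      then show "lead (\<alpha> + \<beta>) 0 = lead \<beta> 0 * lead \<alpha> (\<beta> + 0)"
        by (intro reduce[OF _ _ zero_in refl refl refl refl refl refl])
          (simp_all add: line zero_in add_in div algebra_simps)
    qed
  next
    case (A1 \<gamma>0)
    show thesis
    proof (rule that[OF A1(1)])
      fix \<alpha> \<beta> assume \<alpha>: "\<alpha> \<in> \<Delta>" and \<beta>: "\<beta> \<in> \<Delta>"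
      consider "\<alpha> = 0" | "\<beta> = 0" | "\<alpha> \<noteq> 0" "\<beta> = - \<alpha>" | "\<alpha> \<noteq> 0" "\<beta> \<noteq> 0" "\<alpha> + \<beta> \<noteq> 0"
        by (metis add_eq_0_iff)
      then show "lead (\<alpha> + \<beta>) \<gamma>0 = lead \<beta> \<gamma>0 * lead \<alpha> (\<beta> + \<gamma>0)"
        using A1(2) A1(3)[OF \<alpha>] A1(3)[OF \<beta>] A1(3)[OF add_in[OF \<alpha> \<beta>]]
        by cases (rule reduce[OF \<alpha> \<beta> A1(1) refl refl refl refl refl refl];
            simp add: div algebra_simps)+
    qed
  next
    case (A2 \<gamma>0)
    show thesis
    proof (rule that[OF A2(1)])
      fix \<alpha> \<beta> assume \<alpha>: "\<alpha> \<in> \<Delta>" and \<beta>: "\<beta> \<in> \<Delta>"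
      consider "\<alpha> = 0" | "\<beta> = 0" | "\<alpha> \<noteq> 0" "\<beta> = - \<alpha>" | "\<alpha> \<noteq> 0" "\<beta> \<noteq> 0" "\<alpha> + \<beta> \<noteq> 0"
        by (metis add_eq_0_iff)
      then show "lead (\<alpha> + \<beta>) \<gamma>0 = lead \<beta> \<gamma>0 * lead \<alpha> (\<beta> + \<gamma>0)"
        using A2(2) A2(3)[OF \<alpha>] A2(3)[OF \<beta>] A2(3)[OF add_in[OF \<alpha> \<beta>]]
        by cases (rule reduce[OF \<alpha> \<beta> A2(1) refl refl refl refl refl refl];
            simp add: div algebra_simps)+
    qed
  qed
qed

lemma lead_coboundary:
  obtains \<kappa> where "\<And>\<gamma>. \<gamma> \<in> \<Delta> \<Longrightarrow> \<kappa> \<gamma> \<noteq> 0"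
    and "\<And>\<beta> \<gamma>. \<beta> \<in> \<Delta> \<Longrightarrow> \<gamma> \<in> \<Delta> \<Longrightarrow> \<kappa> (\<beta> + \<gamma>) = \<kappa> \<gamma> * lead \<beta> \<gamma>"
proof -
  obtain \<gamma>0 where \<gamma>0: "\<gamma>0 \<in> \<Delta>"
    and cocycle: "\<And>\<alpha> \<beta>. \<alpha> \<in> \<Delta> \<Longrightarrow> \<beta> \<in> \<Delta> \<Longrightarrow> lead (\<alpha> + \<beta>) \<gamma>0 = lead \<beta> \<gamma>0 * lead \<alpha> (\<beta> + \<gamma>0)"
    using cocycle_at_base by blast
  show thesis
  proof (rule that[of "\<lambda>\<gamma>. lead (\<gamma> - \<gamma>0) \<gamma>0"])
    show "lead (\<gamma> - \<gamma>0) \<gamma>0 \<noteq> 0" if "\<gamma> \<in> \<Delta>" for \<gamma>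
      by (rule lead_nz[OF diff_in[OF that \<gamma>0] \<gamma>0])
    show "lead (\<beta> + \<gamma> - \<gamma>0) \<gamma>0 = lead (\<gamma> - \<gamma>0) \<gamma>0 * lead \<beta> \<gamma>" if "\<beta> \<in> \<Delta>" "\<gamma> \<in> \<Delta>" for \<beta> \<gamma>
      using cocycle[OF that(1) diff_in[OF that(2) \<gamma>0]] by (simp add: add_diff_eq)
  qed
qed

end

section \<open>Structure polynomials of the three families\<close>

text \<open>The quotients by \<open>b\<close> and \<open>\<beta> + b\<close> are given names, here and for the special cases below, which leaves a
  polynomial identity.\<close>

lemma generic_coeff_eq:
  assumes "b \<noteq> 0" "\<beta> + b \<noteq> 0"
  shows "ev_poly (generic_coeff b \<phi> q c \<beta> \<gamma>) d l = (\<beta> + b) *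
    intertwiner 1 (\<beta> / b + 1) (q (\<beta> + \<gamma>)) (d + c - \<phi> (\<beta> + \<gamma>) / b) (l + \<phi> \<beta> / b)"
proof -
  define r f g where "r = b / (\<beta> + b)" and "f = \<phi> \<beta> / b" and "g = \<phi> (\<beta> + \<gamma>) / b"
  have eqs: "\<phi> \<beta> / (\<beta> + b) = r * f" "x / (\<beta> / b + 1) = r * x" for x
    using assms by (simp_all add: r_def f_def field_simps)
  show ?thesis
    unfolding generic_coeff_def intertwiner_def ev_poly_simps eqs r_def[symmetric] f_def[symmetric] g_def[symmetric]
    by (simp add: algebra_simps)
qed

lemma Vce_coeff_eq:
  "ev_poly (Vce_coeff b \<phi> c e \<beta> \<gamma>) d l = ev_poly (generic_coeff b \<phi> (\<lambda>\<gamma>. e + \<gamma> / b) c \<beta> \<gamma>) d l"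
  by (simp add: Vce_coeff_def generic_coeff_def algebra_simps)

context weighted_structure_family
begin

text \<open>The case conditions in the model, which mention only values of \<open>q\<close>, select the degree: a point
  \<open>\<delta> \<noteq> \<gamma>0\<close> has \<open>q \<delta> = 1 + (\<delta> - \<gamma>0)/b\<close>, so outside the two special cases \<open>\<beta> = 0\<close> or both \<open>\<gamma>\<close> and \<open>\<beta> + \<gamma>\<close> are
  different from \<open>\<gamma>0\<close>.\<close>

lemma VA1_coeff_eq:
  assumes \<beta>: "\<beta> \<in> \<Delta>" and \<gamma>: "\<gamma> \<in> \<Delta>" and A1: "sequence_A1 \<Delta> b q"
  shows "ev_poly (VA1_coeff b \<phi> q c \<beta> \<gamma>) d l = (\<beta> + b) *
    intertwiner (deg \<beta> \<gamma>) (\<beta> / b + 1) (q (\<beta> + \<gamma>)) (d + c - \<phi> (\<beta> + \<gamma>) / b) (l + \<phi> \<beta> / b)"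
proof -
  note nz = b_nz shift_nz(1)[OF \<beta>]
  obtain \<gamma>0 where \<gamma>0: "\<gamma>0 \<in> \<Delta>" "q \<gamma>0 = 0" "\<And>\<alpha>. \<alpha> \<in> \<Delta> \<Longrightarrow> \<alpha> \<noteq> 0 \<Longrightarrow> q (\<alpha> + \<gamma>0) = 1 + \<alpha> / b"
    using A1 by (auto simp: sequence_A1_def)
  have generic: "q \<delta> = 1 + (\<delta> - \<gamma>0) / b" if "\<delta> \<in> \<Delta>" "\<delta> \<noteq> \<gamma>0" for \<delta>
    using \<gamma>0(3)[OF diff_in[OF that(1) \<gamma>0(1)]] that(2) by simp
  consider (two) "\<beta> \<noteq> 0" "q (\<beta> + \<gamma>) = 0" "q \<gamma> = 1 - \<beta> / b"
    | (zero) "\<not> (\<beta> \<noteq> 0 \<and> q (\<beta> + \<gamma>) = 0 \<and> q \<gamma> = 1 - \<beta> / b)" "\<beta> \<noteq> 0" "q \<gamma> = 0" "q (\<beta> + \<gamma>) = 1 + \<beta> / b"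
    | (one) "\<not> (\<beta> \<noteq> 0 \<and> q (\<beta> + \<gamma>) = 0 \<and> q \<gamma> = 1 - \<beta> / b)"
        "\<not> (\<beta> \<noteq> 0 \<and> q \<gamma> = 0 \<and> q (\<beta> + \<gamma>) = 1 + \<beta> / b)" by blast
  then show ?thesis
  proof cases
    case two
    then have k: "deg \<beta> \<gamma> = 2" by (intro deg_eqI \<beta> \<gamma>) simp
    define r f g where "r = b / (\<beta> + b)" and "f = \<phi> \<beta> / b" and "g = \<phi> (\<beta> + \<gamma>) / b"
    have eqs: "\<phi> \<beta> / (\<beta> + b) = r * f" "x / (\<beta> / b + 1) = r * x" for x
      using nz by (simp_all add: r_def f_def field_simps)
    have "VA1_coeff b \<phi> q c \<beta> \<gamma> = cst (\<beta> + b) * (inner_var + cst (c - \<phi> (\<beta> + \<gamma>) / b))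
          * (inner_var + cst (b / (\<beta> + b)) * outer_var
             + cst (c - \<phi> (\<beta> + \<gamma>) / b + \<phi> \<beta> / (\<beta> + b)))"
      unfolding VA1_coeff_def using two by (simp only: if_True simp_thms)
    from arg_cong[OF this, of "\<lambda>Q. ev_poly Q d l"] show ?thesis
      unfolding k two(2) intertwiner_def ev_poly_simps eqs r_def[symmetric] f_def[symmetric] g_def[symmetric]
      by (simp add: algebra_simps power2_eq_square)
  next
    case zero
    then have "deg \<beta> \<gamma> = 0" by (intro deg_eqI \<beta> \<gamma>) simp
    with zero nz show ?thesis by (auto simp: VA1_coeff_def intertwiner_def)
  next
    case one
    have "\<beta> = 0 \<or> \<gamma> \<noteq> \<gamma>0 \<and> \<beta> + \<gamma> \<noteq> \<gamma>0"
    proof (rule ccontr)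
      assume "\<not> ?thesis"
      then have "\<beta> \<noteq> 0" "\<gamma> = \<gamma>0 \<or> \<gamma> = - \<beta> + \<gamma>0" by auto
      then show False using one \<gamma>0(2) \<gamma>0(3)[OF \<beta>] \<gamma>0(3)[OF minus_in[OF \<beta>]] by auto
    qed
    then have "deg \<beta> \<gamma> = 1"
      using generic[OF \<gamma>] generic[OF add_in[OF \<beta> \<gamma>]] nz
      by (intro deg_eqI \<beta> \<gamma>) (auto simp: diff_divide_distrib add_divide_distrib)
    with one show ?thesis
      using generic_coeff_eq[OF nz, of \<phi> q c \<gamma> d l] unfolding VA1_coeff_def by (simp only: if_False)
  qed
qed

lemma VA2_coeff_eq:
  assumes \<beta>: "\<beta> \<in> \<Delta>" and \<gamma>: "\<gamma> \<in> \<Delta>" and A2: "sequence_A2 \<Delta> b q"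
  shows "ev_poly (VA2_coeff b \<phi> q c \<beta> \<gamma>) d l = (\<beta> + b) *
    intertwiner (deg \<beta> \<gamma>) (\<beta> / b + 1) (q (\<beta> + \<gamma>)) (d + c - \<phi> (\<beta> + \<gamma>) / b) (l + \<phi> \<beta> / b)"
proof -
  note nz = b_nz shift_nz(1)[OF \<beta>]
  have s: "\<beta> / b + 1 = (\<beta> + b) / b" "1 + 2 * (\<beta> / b) = (2 * \<beta> + b) / b"
    using nz by (simp_all add: field_simps)
  obtain \<gamma>0 where \<gamma>0: "\<gamma>0 \<in> \<Delta>" "q \<gamma>0 = 1" "\<And>\<alpha>. \<alpha> \<in> \<Delta> \<Longrightarrow> \<alpha> \<noteq> 0 \<Longrightarrow> q (\<alpha> + \<gamma>0) = \<alpha> / b"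
    using A2 by (auto simp: sequence_A2_def)
  have generic: "q \<delta> = (\<delta> - \<gamma>0) / b" if "\<delta> \<in> \<Delta>" "\<delta> \<noteq> \<gamma>0" for \<delta>
    using \<gamma>0(3)[OF diff_in[OF that(1) \<gamma>0(1)]] that(2) by simp
  consider (zero) "\<beta> \<noteq> 0" "q (\<beta> + \<gamma>) = 1" "q \<gamma> = - (\<beta> / b)"
    | (two) "\<not> (\<beta> \<noteq> 0 \<and> q (\<beta> + \<gamma>) = 1 \<and> q \<gamma> = - (\<beta> / b))" "\<beta> \<noteq> 0" "q (\<beta> + \<gamma>) = \<beta> / b" "q \<gamma> = 1"
    | (one) "\<not> (\<beta> \<noteq> 0 \<and> q (\<beta> + \<gamma>) = 1 \<and> q \<gamma> = - (\<beta> / b))"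
        "\<not> (\<beta> \<noteq> 0 \<and> q (\<beta> + \<gamma>) = \<beta> / b \<and> q \<gamma> = 1)" by blast
  then show ?thesis
  proof cases
    case zero
    then have "deg \<beta> \<gamma> = 0" by (intro deg_eqI \<beta> \<gamma>) simp
    with zero show ?thesis by (simp add: VA2_coeff_def intertwiner_def)
  next
    case two
    then have k: "deg \<beta> \<gamma> = 2" by (intro deg_eqI \<beta> \<gamma>) simp
    define u v f g where "u = (2 * \<beta> + b) / (\<beta> + b)" and "v = \<beta> / (\<beta> + b)"
      and "f = \<phi> \<beta> / b" and "g = \<phi> (\<beta> + \<gamma>) / b"
    have eqs: "(2 * \<beta> + b) * \<phi> \<beta> / (b * (\<beta> + b)) = u * f"
      "(1 + 2 * (\<beta> / b)) / (\<beta> / b + 1) = u" "\<beta> / b / (\<beta> / b + 1) = v"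
      unfolding s u_def v_def f_def using nz by simp_all
    have "VA2_coeff b \<phi> q c \<beta> \<gamma> = cst (\<beta> + b) *
          ((inner_var + cst (c - \<phi> (\<beta> + \<gamma>) / b))
             * (inner_var + cst ((2 * \<beta> + b) / (\<beta> + b)) * outer_var
                + cst (c - \<phi> (\<beta> + \<gamma>) / b + (2 * \<beta> + b) * \<phi> \<beta> / (b * (\<beta> + b))))
           + cst (\<beta> / (\<beta> + b)) * (outer_var + cst (\<phi> \<beta> / b)) ^ 2)"
      unfolding VA2_coeff_def using two by (simp only: if_False if_True simp_thms)
    from arg_cong[OF this, of "\<lambda>Q. ev_poly Q d l"] show ?thesis
      unfolding k two(3) intertwiner_def ev_poly_simps eqs u_def[symmetric] v_def[symmetric]
        f_def[symmetric] g_def[symmetric]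
      by (simp add: algebra_simps power2_eq_square)
  next
    case one
    have "\<beta> = 0 \<or> \<gamma> \<noteq> \<gamma>0 \<and> \<beta> + \<gamma> \<noteq> \<gamma>0"
    proof (rule ccontr)
      assume "\<not> ?thesis"
      then have "\<beta> \<noteq> 0" "\<gamma> = \<gamma>0 \<or> \<gamma> = - \<beta> + \<gamma>0" by auto
      then show False using one \<gamma>0(2) \<gamma>0(3)[OF \<beta>] \<gamma>0(3)[OF minus_in[OF \<beta>]] by auto
    qed
    then have "deg \<beta> \<gamma> = 1"
      using generic[OF \<gamma>] generic[OF add_in[OF \<beta> \<gamma>]] nz
      by (intro deg_eqI \<beta> \<gamma>) (auto simp: diff_divide_distrib add_divide_distrib)
    with one show ?thesis
      using generic_coeff_eq[OF nz, of \<phi> q c \<gamma> d l] unfolding VA2_coeff_def by (simp only: if_False)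
  qed
qed

end

section \<open>The classification\<close>

text \<open>After rescaling the generators, the structure polynomials depend only on the weights \<open>q\<close> and the
  constant \<open>c\<close>.\<close>

lemma (in graded_basis) normalised_basis:
  assumes b: "2 * b \<notin> \<Delta>" and hom: "additive_hom_on \<Delta> \<phi>"
    and "nontrivial_action (free_carrier \<Delta>) V act"
  obtains c q P m' F' where "weighted_structure_family \<Delta> b P q"
    and "graded_basis \<Delta> b \<phi> scale V act W m' F'"
    and "\<And>\<beta> \<gamma> d l. \<beta> \<in> \<Delta> \<Longrightarrow> \<gamma> \<in> \<Delta> \<Longrightarrow> ev_poly (F' \<beta> \<gamma>) d l = (\<beta> + b) *
      intertwiner (weighted_structure_family.deg b q \<beta> \<gamma>) (\<beta> / b + 1) (q (\<beta> + \<gamma>))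
        (d + c - \<phi> (\<beta> + \<gamma>) / b) (l + \<phi> \<beta> / b)"
proof -
  have \<phi>: "\<phi> (\<alpha> + \<beta>) = \<phi> \<alpha> + \<phi> \<beta>" if "\<alpha> \<in> \<Delta>" "\<beta> \<in> \<Delta>" for \<alpha> \<beta>
    using hom that by (simp add: additive_hom_on_def)
  have b_nz: "b \<noteq> 0" using b subgroup by (auto simp: additive_subgroup_of_complex_def)
  have "\<exists>P. \<forall>\<beta> \<gamma> d l. ev_poly (P \<beta> \<gamma>) d l = ev_poly (F \<beta> \<gamma>) (d + \<phi> (\<beta> + \<gamma>) / b - c) (l - \<phi> \<beta> / b)" for c
    using ex_ev_poly_subst[of "F _ _" "inner_var + cst (\<phi> (_ + _) / b - c)" "outer_var - cst (\<phi> _ / b)"]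
    by (auto simp: add_diff_eq intro!: choice)
  then obtain shifted where shifted: "\<And>c \<beta> \<gamma> d l. ev_poly (shifted c \<beta> \<gamma>) d l =
      ev_poly (F \<beta> \<gamma>) (d + \<phi> (\<beta> + \<gamma>) / b - c) (l - \<phi> \<beta> / b)" by metis
  have family: "structure_family \<Delta> b (shifted c)" for c
  proof (rule structure_family.intro[OF subgroup b])
    fix \<alpha> \<beta> \<gamma> l m d assume \<alpha>: "\<alpha> \<in> \<Delta>" and \<beta>: "\<beta> \<in> \<Delta>" and \<gamma>: "\<gamma> \<in> \<Delta>"
    define l' m' d' where "l' = l - \<phi> \<alpha> / b" and "m' = m - \<phi> \<beta> / b"
      and "d' = d + (\<phi> \<alpha> + \<phi> \<beta> + \<phi> \<gamma>) / b - c"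
    have lmd: "l = l' + \<phi> \<alpha> / b" "m = m' + \<phi> \<beta> / b" "d = d' - (\<phi> \<alpha> + \<phi> \<beta> + \<phi> \<gamma>) / b + c"
      by (simp_all add: l'_def m'_def d'_def)
    have "ev_poly (CL_coeff b \<phi> \<alpha> \<beta>) (- (l' + m')) l' = (\<beta> + b) * l - (\<alpha> + b) * m"
      using b_nz by (simp add: CL_coeff_def lmd field_simps)
    with structure_identity[OF \<alpha> \<beta> \<gamma>, where l = l' and \<mu> = m' and d = d']
    show "((\<beta> + b) * l - (\<alpha> + b) * m) * ev_poly (shifted c (\<alpha> + \<beta>) \<gamma>) d (l + m) =
      ev_poly (shifted c \<beta> \<gamma>) (d + l) m * ev_poly (shifted c \<alpha> (\<beta> + \<gamma>)) d l
      - ev_poly (shifted c \<alpha> \<gamma>) (d + m) l * ev_poly (shifted c \<beta> (\<alpha> + \<gamma>)) d m"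
      by (simp add: shifted \<phi> \<alpha> \<beta> \<gamma> add_closed lmd add_divide_distrib add_ac)
  qed
  obtain \<alpha> \<gamma> where \<alpha>\<gamma>: "\<alpha> \<in> \<Delta>" "\<gamma> \<in> \<Delta>" "F \<alpha> \<gamma> \<noteq> 0"
    using nontrivial_structure[OF assms(3)] .
  have "shifted 0 \<alpha> \<gamma> \<noteq> 0"
  proof
    assume "shifted 0 \<alpha> \<gamma> = 0"
    then have "ev_poly (F \<alpha> \<gamma>) d l = 0" for d l
      using shifted[of 0 \<alpha> \<gamma> "d - \<phi> (\<alpha> + \<gamma>) / b" "l + \<phi> \<alpha> / b"] by simp
    with \<alpha>\<gamma>(3) ev_poly_eqI[of "F \<alpha> \<gamma>" 0] show False by simp
  qed
  with structure_family.virasoro_weights[OF family \<alpha>\<gamma>(1,2)] obtain c q where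
    weights: "\<And>\<delta> d l. \<delta> \<in> \<Delta> \<Longrightarrow> ev_poly (shifted 0 0 \<delta>) d l = b * (d + c + q \<delta> * l)" by metis
  have "ev_poly (shifted c 0 \<delta>) d l = b * (d + q \<delta> * l)" if "\<delta> \<in> \<Delta>" for \<delta> d l
    using weights[OF that, of "d - c" l] by (simp add: shifted algebra_simps)
  then interpret weighted_structure_family \<Delta> b "shifted c" q
    by (intro weighted_structure_family.intro family weighted_structure_family_axioms.intro)
  obtain \<kappa> where \<kappa>: "\<And>\<gamma>. \<gamma> \<in> \<Delta> \<Longrightarrow> \<kappa> \<gamma> \<noteq> 0"
    "\<And>\<beta> \<gamma>. \<beta> \<in> \<Delta> \<Longrightarrow> \<gamma> \<in> \<Delta> \<Longrightarrow> \<kappa> (\<beta> + \<gamma>) = \<kappa> \<gamma> * lead \<beta> \<gamma>"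
    using lead_coboundary by blast
  show thesis
  proof (rule that[OF weighted_structure_family_axioms rescale[OF \<kappa>(1)]])
    fix \<beta> \<gamma> d l assume \<beta>: "\<beta> \<in> \<Delta>" and \<gamma>: "\<gamma> \<in> \<Delta>"
    have "ev_poly (F \<beta> \<gamma>) d l = ev_poly (shifted c \<beta> \<gamma>) (d + c - \<phi> (\<beta> + \<gamma>) / b) (l + \<phi> \<beta> / b)"
      by (simp add: shifted)
    then show "ev_poly (cst (\<kappa> \<gamma> / \<kappa> (\<beta> + \<gamma>)) * F \<beta> \<gamma>) d l = (\<beta> + b) *
      intertwiner (deg \<beta> \<gamma>) (\<beta> / b + 1) (q (\<beta> + \<gamma>))
        (d + c - \<phi> (\<beta> + \<gamma>) / b) (l + \<phi> \<beta> / b)"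
      using \<kappa>(1)[OF \<gamma>] lead_nz[OF \<beta> \<gamma>] by (simp add: P_eq \<beta> \<gamma> \<kappa>(2))
  qed
qed

theorem theorem6p19:
  fixes \<Delta> :: "complex set" and b :: complex and \<phi> :: "complex \<Rightarrow> complex"
    and scale :: "complex poly \<Rightarrow> 'v::ab_group_add \<Rightarrow> 'v"
    and V :: "'v set"
    and act :: "free_elem \<Rightarrow> 'v \<Rightarrow> 'v poly"
    and W :: "complex \<Rightarrow> 'v set"
  assumes "additive_subgroup_of_complex \<Delta>" and "infinite \<Delta>"
    and "2 * b \<notin> \<Delta>"
    and "additive_hom_on \<Delta> \<phi>"
    and "graded_CL_module \<Delta> b \<phi> scale V act W"
    and "free_intermediate_series \<Delta> scale W"
    and "nontrivial_action (free_carrier \<Delta>) V act"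
  shows
    "(\<exists>c e. conformal_modules_isomorphic (free_carrier \<Delta>) scale V act
               free_scale (free_carrier \<Delta>) (Vce_act b \<phi> c e))
     \<or> (\<exists>c q. sequence_A1 \<Delta> b q \<and>
             conformal_modules_isomorphic (free_carrier \<Delta>) scale V act
               free_scale (free_carrier \<Delta>) (VA1_act b \<phi> q c))
     \<or> (\<exists>c q. sequence_A2 \<Delta> b q \<and>
             conformal_modules_isomorphic (free_carrier \<Delta>) scale V act
               free_scale (free_carrier \<Delta>) (VA2_act b \<phi> q c))"
proof -
  obtain m F where basis: "graded_basis \<Delta> b \<phi> scale V act W m F"
    using ex_graded_basis[OF assms(1,5,6)] .
  obtain c q P m' F' where family: "weighted_structure_family \<Delta> b P q"
    and basis': "graded_basis \<Delta> b \<phi> scale V act W m' F'"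
    and F': "\<And>\<beta> \<gamma> d l. \<beta> \<in> \<Delta> \<Longrightarrow> \<gamma> \<in> \<Delta> \<Longrightarrow> ev_poly (F' \<beta> \<gamma>) d l = (\<beta> + b) *
      intertwiner (weighted_structure_family.deg b q \<beta> \<gamma>) (\<beta> / b + 1) (q (\<beta> + \<gamma>))
        (d + c - \<phi> (\<beta> + \<gamma>) / b) (l + \<phi> \<beta> / b)"
    using graded_basis.normalised_basis[OF basis assms(3,4,7)] by metis
  interpret weighted_structure_family \<Delta> b P q by (rule family)
  have iso: "conformal_modules_isomorphic (free_carrier \<Delta>) scale V act
      free_scale (free_carrier \<Delta>) (sesqui_extend Q)"
    if "\<And>\<beta> \<gamma> d l. \<beta> \<in> \<Delta> \<Longrightarrow> \<gamma> \<in> \<Delta> \<Longrightarrow> ev_poly (Q \<beta> \<gamma>) d l = (\<beta> + b) *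
      intertwiner (deg \<beta> \<gamma>) (\<beta> / b + 1) (q (\<beta> + \<gamma>)) (d + c - \<phi> (\<beta> + \<gamma>) / b) (l + \<phi> \<beta> / b)" for Q
    using that F' by (intro graded_basis.isomorphic_sesqui_extend[OF basis'] ev_poly_eqI) simp
  show ?thesis
  proof (cases rule: weights_classification)
    case (line e)
    have "deg \<beta> \<gamma> = 1" if "\<beta> \<in> \<Delta>" "\<gamma> \<in> \<Delta>" for \<beta> \<gamma>
      using that by (intro deg_eqI) (simp_all add: line add_in add_divide_distrib)
    then have "conformal_modules_isomorphic (free_carrier \<Delta>) scale V act
        free_scale (free_carrier \<Delta>) (Vce_act b \<phi> c e)"
      unfolding Vce_act_def
      by (intro iso) (simp add: Vce_coeff_eq generic_coeff_eq b_nz shift_nz line add_in)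
    then show ?thesis by blast
  next
    case (A1 \<gamma>0)
    then have seq: "sequence_A1 \<Delta> b q" by (auto simp: sequence_A1_def)
    then have "conformal_modules_isomorphic (free_carrier \<Delta>) scale V act
        free_scale (free_carrier \<Delta>) (VA1_act b \<phi> q c)"
      unfolding VA1_act_def by (intro iso VA1_coeff_eq)
    with seq show ?thesis by blast
  next
    case (A2 \<gamma>0)
    then have seq: "sequence_A2 \<Delta> b q" by (auto simp: sequence_A2_def)
    then have "conformal_modules_isomorphic (free_carrier \<Delta>) scale V act
        free_scale (free_carrier \<Delta>) (VA2_act b \<phi> q c)"
      unfolding VA2_act_def by (intro iso VA2_coeff_eq)
    with seq show ?thesis by blast
  qed
qed

end
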